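(* Let $M,\widehat M$ be oriented connected $n$-dimensional Riemannian manifolds with isometric imbeddings $\iota,\widehat\iota$ into $\mathbb{R}^{n+\nu}$. If a curve $(x,g):[0,\tau]\to M\times\mathrm{Isom}^+(\mathbb{R}^{n+\nu})$ is a rolling of $M$ on $\widehat M$, then $$t\mapsto (dg(t)|_{T_{x(t)}M},\,dg(t)|_{T_{x(t)}M^\perp})=:(q(t),p(t))$$ defines a curve in $Q\oplus P_{\iota,\widehat\iota}$ with the following properties, where $\widehat x(t)=g(t)x(t)$: (I) $\dot{\widehat x}(t)=q(t)\dot x(t)$ for almost every $t$; (II) $q(t)\frac{D}{dt}Z(t)=\frac{D}{dt}q(t)Z(t)$ for any tangent vector field $Z(t)$ along $x(t)$ and almost every $t$; (III) $p(t)\frac{D^\perp}{dt}\Psi(t)=\frac{D^\perp}{dt}p(t)\Psi(t)$ for any normal vector field $\Psi(t)$ along $x(t)$ and almost every $t$. Conversely, if $(q,p):[0,\tau]\to Q\oplus P_{\iota,\widehat\iota}$ is an absolutely continuous curve, with projection $(x(t),\widehat x(t))$ to $M\times\widehat M$, satisfying (I)-(III), then there exists a unique rolling $(x,g):[0,\tau]\to M\times\mathrm{Isom}^+(\mathbb{R}^{n+\nu})$ such that $dg(t)|_{T_{x(t)}M}=q(t)$ and $dg(t)|_{T_{x(t)}M^\perp}=p(t)$.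
   Context: $\mathbb{R}^{n+\nu}$ has its standard metric and orientation; $M,\widehat M$ are identified with their images, and $T_x\mathbb{R}^{n+\nu}=T_xM\oplus T_xM^\perp$ (similarly for $\widehat M$), with $v=v^\top+v^\perp$; normal spaces carry the orientation induced from $M$ (resp. $\widehat M$) and $\mathbb{R}^{n+\nu}$. For (absolutely continuous) tangent fields $Z(t)$ and normal fields $\Psi(t)$ along a curve, $\frac{D}{dt}Z=(\dot Z)^\top$, $\frac{D^\perp}{dt}\Psi=(\dot\Psi)^\perp$. $\mathrm{Isom}^+(\mathbb{R}^{n+\nu})$ is the group of orientation preserving isometries. A rolling of $M$ on $\widehat M$ is an absolutely continuous curve $(x,g):[0,\tau]\to M\times\mathrm{Isom}^+(\mathbb{R}^{n+\nu})$ such that: (i') $\widehat x(t):=g(t)x(t)\in\widehat M$; (ii') $dg(t)T_{x(t)}M=T_{\widehat x(t)}\widehat M$; (iii') $\dot{\widehat x}(t)=dg(t)\dot x(t)$ for a.e. $t$; (iv') $dg(t)\frac{D}{dt}Z(t)=\frac{D}{dt}dg(t)Z(t)$ for any tangent field $Z$ along $x$ and a.e. $t$; (v') $dg(t)\frac{D^\perp}{dt}\Psi(t)=\frac{D^\perp}{dt}dg(t)\Psi(t)$ for any normal field $\Psi$ along $x$ and a.e. $t$; (vi') $d_{x(t)}g(t)|_{T_{x(t)}M}:T_{x(t)}M\to T_{\widehat x(t)}\widehat M$ is orientation preserving. For oriented inner product spaces, $\mathrm{Isom}_0^+(V,\widehat V)$ is the set of linear orientation preserving isometries. $Q=\{q\in\mathrm{Isom}_0^+(T_xM,T_{\widehat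 x}\widehat M): x\in M,\widehat x\in\widehat M\}$ and $P_{\iota,\widehat\iota}=\{p\in\mathrm{Isom}_0^+(T_xM^\perp,T_{\widehat x}\widehat M^\perp): x\in M,\widehat x\in\widehat M\}$ are bundles over $M\times\widehat M$ with fibers diffeomorphic to $\mathrm{SO}(n)$ and $\mathrm{SO}(\nu)$; $Q\oplus P_{\iota,\widehat\iota}$ is their fibre product over $M\times\widehat M$. *)

theory Defs
  imports "HOL-Analysis.Analysis"
begin

text \<open>\<open>Ck_on k f S\<close> means that \<open>f\<close> is of class $C^k$; it is meant for open \<open>S\<close> only.\<close>

fun Ck_on :: "nat \<Rightarrow> ('a::real_normed_vector \<Rightarrow> 'b::real_normed_vector) \<Rightarrow> 'a set \<Rightarrow> bool" where
  "Ck_on 0 f S \<longleftrightarrow> continuous_on S f"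
| "Ck_on (Suc k) f S \<longleftrightarrow> (\<forall>x\<in>S. f differentiable (at x)) \<and>
     (\<forall>v. Ck_on k (\<lambda>x. frechet_derivative f (at x) v) S)"

definition smooth_on :: "('a::real_normed_vector \<Rightarrow> 'b::real_normed_vector) \<Rightarrow> 'a set \<Rightarrow> bool" where
  "smooth_on f S \<longleftrightarrow> (\<forall>k. Ck_on k f S)"

definition abs_continuous :: "real \<Rightarrow> real \<Rightarrow> (real \<Rightarrow> 'a::metric_space) \<Rightarrow> bool" where
  "abs_continuous a b f \<longleftrightarrow>
     (\<forall>\<epsilon>>0. \<exists>\<delta>>0. \<forall>(m::nat) u v.
        (\<forall>i<m. a \<le> u i \<and> u i \<le> v i \<and> v i \<le> b) \<and>
        (\<forall>i<m. \<forall>j<m. i \<noteq> j \<longrightarrow> {u i<..<v i} \<inter> {u j<..<v j} = {}) \<and>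
        (\<Sum>i<m. v i - u i) < \<delta>
        \<longrightarrow> (\<Sum>i<m. dist (f (u i)) (f (v i))) < \<epsilon>)"

text \<open>\<open>proj V v\<close> is the \<open>V\<close>-component of \<open>v\<close> in the decomposition of the ambient space as
  the direct sum of \<open>V\<close> and its orthogonal complement.\<close>

definition proj :: "'v::euclidean_space set \<Rightarrow> 'v \<Rightarrow> 'v" where
  "proj V v = (THE a. a \<in> V \<and> v - a \<in> V\<^sup>\<bottom>)"

text \<open>A linear map defined on a subspace \<open>V\<close> only is represented by its extension by zero
  on the orthogonal complement of \<open>V\<close>. Thus \<open>restr L V\<close> stands for the restriction of \<open>L\<close>
  to \<open>V\<close>, and two such representatives are equal iff the maps on \<open>V\<close> are.\<close>

definition restr :: "('v::euclidean_space \<Rightarrow> 'w) \<Rightarrow> 'v set \<Rightarrow> 'v \<Rightarrow> 'w" where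
  "restr L V = (\<lambda>v. L (proj V v))"

text \<open>Ordered bases are indexed from 0; values at indices \<open>i \<ge> dim V\<close> are irrelevant.\<close>

type_synonym 'v frame = "nat \<Rightarrow> 'v"
type_synonym 'v orientation_field = "'v \<Rightarrow> 'v frame set"

text \<open>Used instead of \<open>real^'k\<close>, which fixes the sort of \<open>'k\<close> to \<open>finite\<close>.\<close>

type_synonym 'k euc = "(real, 'k) vec"

definition is_frame :: "'v::euclidean_space set \<Rightarrow> 'v frame \<Rightarrow> bool" where
  "is_frame V b \<longleftrightarrow> inj_on b {..<dim V} \<and> independent (b ` {..<dim V}) \<and> span (b ` {..<dim V}) = V"

text \<open>The change of basis from \<open>b\<close> to \<open>c\<close> has positive determinant. The determinant of an
  automorphism of \<open>V\<close> is computed after extending it by the identity on the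
  orthogonal complement of \<open>V\<close>.\<close>

definition same_oriented :: "('k::finite) euc set \<Rightarrow> 'k euc frame \<Rightarrow> 'k euc frame \<Rightarrow> bool" where
  "same_oriented V b c \<longleftrightarrow>
     (\<exists>L. linear L \<and> (\<forall>i<dim V. L (b i) = c i) \<and> (\<forall>w\<in>V\<^sup>\<bottom>. L w = w) \<and> det (matrix L) > 0)"

text \<open>An orientation of \<open>V\<close> is given by the set of its positive frames. Stated in this form,
  the definition allows both signs for a zero-dimensional \<open>V\<close> (where every frame is the
  empty frame, which may be positive or negative); if \<open>dim V > 0\<close>, it says that the
  positive frames form one of the two classes of frames under \<open>same_oriented\<close>.\<close>

definition is_orientation :: "('k::finite) euc set \<Rightarrow> 'k euc frame set \<Rightarrow> bool" where
  "is_orientation V Or \<longleftrightarrow> Or \<subseteq> {b. is_frame V b} \<and>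
     (\<forall>b c. is_frame V b \<and> is_frame V c \<longrightarrow> ((b \<in> Or \<longleftrightarrow> c \<in> Or) \<longleftrightarrow> same_oriented V b c))"

definition orientation_preserving ::
  "('k::finite) euc set \<Rightarrow> 'k euc frame set \<Rightarrow> 'k euc frame set \<Rightarrow> ('k euc \<Rightarrow> 'k euc) \<Rightarrow> bool" where
  "orientation_preserving V Or Or' L \<longleftrightarrow> (\<forall>b. is_frame V b \<longrightarrow> (b \<in> Or \<longleftrightarrow> L \<circ> b \<in> Or'))"

text \<open>Positive frames of the ambient space for its standard orientation: the standard basis is
  ordered by the order of the index type, so \<open>card {j. j < i}\<close> is the position of \<open>i\<close>.\<close>

definition std_positive :: "('k::{finite,linorder}) euc frame \<Rightarrow> bool" where
  "std_positive b \<longleftrightarrow> det (\<chi> i. b (card {j. j < i})) > 0"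

definition append_frame :: "nat \<Rightarrow> 'v frame \<Rightarrow> 'v frame \<Rightarrow> 'v frame" where
  "append_frame d v w = (\<lambda>i. if i < d then v i else w (i - d))"

text \<open>An isometrically imbedded manifold is identified with its image, described by slice charts, and
  carries the metric induced by the ambient inner product.\<close>

definition embedded_submanifold :: "nat \<Rightarrow> 'v::euclidean_space set \<Rightarrow> bool" where
  "embedded_submanifold n M \<longleftrightarrow>
     (\<forall>x\<in>M. \<exists>U W \<phi> \<psi> S. open U \<and> x \<in> U \<and> open (W :: 'v set) \<and>
        homeomorphism U W \<phi> \<psi> \<and> smooth_on \<phi> U \<and> smooth_on \<psi> W \<and>
        subspace S \<and> dim S = n \<and> \<phi> ` (M \<inter> U) = S \<inter> W)"

definition tangent_space :: "'v::euclidean_space set \<Rightarrow> 'v \<Rightarrow> 'v set" where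
  "tangent_space M x =
     {v. \<exists>\<gamma> e. e > 0 \<and> smooth_on \<gamma> {-e<..<e} \<and> \<gamma> ` {-e<..<e} \<subseteq> M \<and>
         \<gamma> 0 = x \<and> (\<gamma> has_vector_derivative v) (at 0)}"

abbreviation normal_space :: "'v::euclidean_space set \<Rightarrow> 'v \<Rightarrow> 'v set" where
  "normal_space M x \<equiv> (tangent_space M x)\<^sup>\<bottom>"

text \<open>An orientation of a submanifold: an orientation of every tangent space that is locally of
  constant sign on a continuous tangent frame.\<close>

definition oriented_submanifold ::
  "nat \<Rightarrow> ('k::finite) euc set \<Rightarrow> 'k euc orientation_field \<Rightarrow> bool" where
  "oriented_submanifold n M orient \<longleftrightarrow> embedded_submanifold n M \<and>
     (\<forall>x\<in>M. is_orientation (tangent_space M x) (orient x)) \<and>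
     (\<forall>x\<in>M. \<exists>U X. open U \<and> x \<in> U \<and> (\<forall>i<n. continuous_on (M \<inter> U) (\<lambda>y. X y i)) \<and>
        (\<forall>y\<in>M \<inter> U. is_frame (tangent_space M y) (X y)) \<and>
        ((\<forall>y\<in>M \<inter> U. X y \<in> orient y) \<or> (\<forall>y\<in>M \<inter> U. X y \<notin> orient y)))"

text \<open>The orientation of the normal space induced by those of the submanifold and of the ambient
  space: a tangent frame followed by a positive normal frame is positive in the ambient
  space iff the tangent frame is positive.\<close>

definition normal_orientation ::
  "('k::{finite,linorder}) euc set \<Rightarrow> 'k euc orientation_field \<Rightarrow> 'k euc orientation_field" where
  "normal_orientation M orient x =
     {w. is_frame (normal_space M x) w \<and>
         (\<forall>v. is_frame (tangent_space M x) v \<longrightarrow>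
            (v \<in> orient x \<longleftrightarrow> std_positive (append_frame (dim (tangent_space M x)) v w)))}"

text \<open>Linear orientation preserving isometries from \<open>V\<close> onto \<open>V'\<close>, extended by zero
  as in \<open>restr\<close>.\<close>

definition Isom0_plus ::
  "('k::finite) euc set \<Rightarrow> 'k euc frame set \<Rightarrow> 'k euc set \<Rightarrow> 'k euc frame set \<Rightarrow> ('k euc \<Rightarrow> 'k euc) set" where
  "Isom0_plus V Or V' Or' =
     {L. linear L \<and> L ` V = V' \<and> (\<forall>v\<in>V. \<forall>w\<in>V. L v \<bullet> L w = v \<bullet> w) \<and>
         orientation_preserving V Or Or' L \<and> (\<forall>w\<in>V\<^sup>\<bottom>. L w = 0)}"

text \<open>Points of the bundles are recorded together with their two base points.\<close>

definition Q_bundle ::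
  "('k::finite) euc set \<Rightarrow> 'k euc orientation_field \<Rightarrow> 'k euc set \<Rightarrow> 'k euc orientation_field \<Rightarrow>
   ('k euc \<times> 'k euc \<times> ('k euc \<Rightarrow> 'k euc)) set" where
  "Q_bundle M orM M' orM' =
     {(x, x', q). x \<in> M \<and> x' \<in> M' \<and>
        q \<in> Isom0_plus (tangent_space M x) (orM x) (tangent_space M' x') (orM' x')}"

definition P_bundle ::
  "('k::{finite,linorder}) euc set \<Rightarrow> 'k euc orientation_field \<Rightarrow> 'k euc set \<Rightarrow> 'k euc orientation_field \<Rightarrow>
   ('k euc \<times> 'k euc \<times> ('k euc \<Rightarrow> 'k euc)) set" where
  "P_bundle M orM M' orM' =
     {(x, x', p). x \<in> M \<and> x' \<in> M' \<and>
        p \<in> Isom0_plus (normal_space M x) (normal_orientation M orM x)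
              (normal_space M' x') (normal_orientation M' orM' x')}"

definition QP_bundle ::
  "('k::{finite,linorder}) euc set \<Rightarrow> 'k euc orientation_field \<Rightarrow> 'k euc set \<Rightarrow> 'k euc orientation_field \<Rightarrow>
   ('k euc \<times> 'k euc \<times> ('k euc \<Rightarrow> 'k euc) \<times> ('k euc \<Rightarrow> 'k euc)) set" where
  "QP_bundle M orM M' orM' =
     {(x, x', q, p). (x, x', q) \<in> Q_bundle M orM M' orM' \<and> (x, x', p) \<in> P_bundle M orM M' orM'}"

text \<open>Absolute continuity in the bundle is tested in the ambient Euclidean space, in which the
  bundle is embedded by sending the extended linear maps to their matrices.\<close>

definition ac_curve_in_QP ::
  "real \<Rightarrow> ('k::{finite,linorder}) euc set \<Rightarrow> 'k euc orientation_field \<Rightarrow> 'k euc set \<Rightarrow> 'k euc orientation_field \<Rightarrow>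
   (real \<Rightarrow> 'k euc) \<Rightarrow> (real \<Rightarrow> 'k euc) \<Rightarrow> (real \<Rightarrow> 'k euc \<Rightarrow> 'k euc) \<Rightarrow> (real \<Rightarrow> 'k euc \<Rightarrow> 'k euc) \<Rightarrow> bool" where
  "ac_curve_in_QP \<tau> M orM M' orM' x x' q p \<longleftrightarrow>
     (\<forall>t\<in>{0..\<tau>}. (x t, x' t, q t, p t) \<in> QP_bundle M orM M' orM') \<and>
     abs_continuous 0 \<tau> (\<lambda>t. (x t, x' t, matrix (q t), matrix (p t)))"

text \<open>\<open>E t\<close> is the tangent (resp. normal) space at \<open>x t\<close>.\<close>

definition ac_field_along :: "real \<Rightarrow> (real \<Rightarrow> 'v::euclidean_space set) \<Rightarrow> (real \<Rightarrow> 'v) \<Rightarrow> bool" where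
  "ac_field_along \<tau> E Z \<longleftrightarrow> abs_continuous 0 \<tau> Z \<and> (\<forall>t\<in>{0..\<tau>}. Z t \<in> E t)"

text \<open>\<open>Y\<close> is the covariant derivative $DZ/dt$ (resp. $D^\perp Z/dt$) at \<open>t\<close>, where
  \<open>V\<close> is the tangent (resp. normal) space at the base point of \<open>Z t\<close>.\<close>

definition has_covariant_derivative ::
  "(real \<Rightarrow> 'v::euclidean_space) \<Rightarrow> 'v \<Rightarrow> 'v set \<Rightarrow> real \<Rightarrow> bool" where
  "has_covariant_derivative Z Y V t \<longleftrightarrow> (\<exists>w. (Z has_vector_derivative w) (at t) \<and> Y = proj V w)"

text \<open>In the following two conditions the derivatives are part of the condition; all curves
  involved are absolutely continuous, hence differentiable almost everywhere.\<close>

definition maps_velocity ::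
  "real \<Rightarrow> (real \<Rightarrow> 'v::euclidean_space) \<Rightarrow> (real \<Rightarrow> 'v) \<Rightarrow> (real \<Rightarrow> 'v \<Rightarrow> 'v) \<Rightarrow> bool" where
  "maps_velocity \<tau> x x' L \<longleftrightarrow>
     (AE t in lebesgue_on {0..\<tau>}. \<exists>v. (x has_vector_derivative v) (at t) \<and>
        (x' has_vector_derivative L t v) (at t))"

definition commutes_with_D ::
  "real \<Rightarrow> (real \<Rightarrow> 'v::euclidean_space set) \<Rightarrow> (real \<Rightarrow> 'v set) \<Rightarrow> (real \<Rightarrow> 'v \<Rightarrow> 'v) \<Rightarrow> bool" where
  "commutes_with_D \<tau> E E' L \<longleftrightarrow>
     (\<forall>Z. ac_field_along \<tau> E Z \<longrightarrow>
        (AE t in lebesgue_on {0..\<tau>}. \<exists>Y. has_covariant_derivative Z Y (E t) t \<and>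
           has_covariant_derivative (\<lambda>s. L s (Z s)) (L t Y) (E' t) t))"

definition Isom_plus :: "(('k::finite) euc \<Rightarrow> 'k euc) set" where
  "Isom_plus = {g. (\<forall>y z. dist (g y) (g z) = dist y z) \<and>
                   (\<forall>y. det (matrix (frechet_derivative g (at y))) > 0)}"

text \<open>Absolute continuity of a curve of isometries refers to the usual coordinates of the Lie group
  of isometries, viz. linear part and translation part.\<close>

definition abs_continuous_isom :: "real \<Rightarrow> real \<Rightarrow> (real \<Rightarrow> ('k::finite) euc \<Rightarrow> 'k euc) \<Rightarrow> bool" where
  "abs_continuous_isom a b g \<longleftrightarrow>
     abs_continuous a b (\<lambda>t. (matrix (frechet_derivative (g t) (at 0)), g t 0))"

definition diff_along ::
  "(real \<Rightarrow> 'v::euclidean_space) \<Rightarrow> (real \<Rightarrow> 'v \<Rightarrow> 'v) \<Rightarrow> real \<Rightarrow> 'v \<Rightarrow> 'v" where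
  "diff_along x g t = frechet_derivative (g t) (at (x t))"

definition is_rolling ::
  "real \<Rightarrow> ('k::finite) euc set \<Rightarrow> 'k euc orientation_field \<Rightarrow> 'k euc set \<Rightarrow> 'k euc orientation_field \<Rightarrow>
   (real \<Rightarrow> 'k euc) \<Rightarrow> (real \<Rightarrow> 'k euc \<Rightarrow> 'k euc) \<Rightarrow> bool" where
  "is_rolling \<tau> M orM M' orM' x g \<longleftrightarrow>
     (let x' = (\<lambda>t. g t (x t)); dg = diff_along x g in
      (\<forall>t\<in>{0..\<tau>}. x t \<in> M \<and> g t \<in> Isom_plus) \<and>
      abs_continuous 0 \<tau> x \<and> abs_continuous_isom 0 \<tau> g \<and>
      (\<forall>t\<in>{0..\<tau>}. x' t \<in> M') \<and>
      (\<forall>t\<in>{0..\<tau>}. dg t ` tangent_space M (x t) = tangent_space M' (x' t)) \<and>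
      maps_velocity \<tau> x x' dg \<and>
      commutes_with_D \<tau> (\<lambda>t. tangent_space M (x t)) (\<lambda>t. tangent_space M' (x' t)) dg \<and>
      commutes_with_D \<tau> (\<lambda>t. normal_space M (x t)) (\<lambda>t. normal_space M' (x' t)) dg \<and>
      (\<forall>t\<in>{0..\<tau>}. orientation_preserving (tangent_space M (x t)) (orM (x t)) (orM' (x' t)) (dg t)))"

definition tangent_part ::
  "'v::euclidean_space set \<Rightarrow> (real \<Rightarrow> 'v) \<Rightarrow> (real \<Rightarrow> 'v \<Rightarrow> 'v) \<Rightarrow> real \<Rightarrow> 'v \<Rightarrow> 'v" where
  "tangent_part M x g t = restr (diff_along x g t) (tangent_space M (x t))"

definition normal_part ::
  "'v::euclidean_space set \<Rightarrow> (real \<Rightarrow> 'v) \<Rightarrow> (real \<Rightarrow> 'v \<Rightarrow> 'v) \<Rightarrow> real \<Rightarrow> 'v \<Rightarrow> 'v" where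
  "normal_part M x g t = restr (diff_along x g t) (normal_space M (x t))"

text \<open>Equality with the given curve \<open>(x, x', q, p)\<close> in the fibre product on \<open>[0,\<tau>]\<close> includes
  equality of base points, that is, of the domains and codomains of the linear maps.\<close>

definition induces ::
  "real \<Rightarrow> 'v::euclidean_space set \<Rightarrow> (real \<Rightarrow> 'v) \<Rightarrow> (real \<Rightarrow> 'v \<Rightarrow> 'v) \<Rightarrow>
   (real \<Rightarrow> 'v) \<Rightarrow> (real \<Rightarrow> 'v) \<Rightarrow> (real \<Rightarrow> 'v \<Rightarrow> 'v) \<Rightarrow> (real \<Rightarrow> 'v \<Rightarrow> 'v) \<Rightarrow> bool" where
  "induces \<tau> M y g x x' q p \<longleftrightarrow>
     (\<forall>t\<in>{0..\<tau>}. y t = x t \<and> g t (y t) = x' t \<and> tangent_part M y g t = q t \<and> normal_part M y g t = p t)"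

definition intrinsic_rolling_conditions ::
  "real \<Rightarrow> 'v::euclidean_space set \<Rightarrow> 'v set \<Rightarrow>
   (real \<Rightarrow> 'v) \<Rightarrow> (real \<Rightarrow> 'v) \<Rightarrow> (real \<Rightarrow> 'v \<Rightarrow> 'v) \<Rightarrow> (real \<Rightarrow> 'v \<Rightarrow> 'v) \<Rightarrow> bool" where
  "intrinsic_rolling_conditions \<tau> M M' x x' q p \<longleftrightarrow>
     maps_velocity \<tau> x x' q \<and>
     commutes_with_D \<tau> (\<lambda>t. tangent_space M (x t)) (\<lambda>t. tangent_space M' (x' t)) q \<and>
     commutes_with_D \<tau> (\<lambda>t. normal_space M (x t)) (\<lambda>t. normal_space M' (x' t)) p"

end

theory Submission
  imports Defs
begin

text \<open>A rolling determines \<open>q\<close> and \<open>p\<close> by restriction of the linear part \<open>A\<close> of \<open>g\<close>, and conversely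
  \<open>A = q + p\<close> (both extended by zero) and \<open>g(t)y = x'(t) + A(t)(y - x(t))\<close>, which gives existence and
  uniqueness at once. Conditions (I)--(III) are the same for \<open>A\<close> and for \<open>q\<close>, \<open>p\<close>, as velocities are tangent.
  Two points need work. Absolute continuity of \<open>q\<close> and \<open>p\<close> requires that the orthogonal projection onto
  the tangent space is a locally Lipschitz function of the base point; this follows from the slice charts.
  Secondly, for a linear bijection \<open>A\<close> respecting the two splittings and preserving tangent orientations,
  \<open>det A > 0\<close> is equivalent to preserving the induced normal orientations: \<open>A\<close> multiplies the
  determinant of a tangent frame followed by a normal frame by \<open>det A\<close>.\<close>

section \<open>Absolutely continuous curves\<close>

text \<open>The definition of \<open>tangent_space\<close> by smooth curves shows neither that it is
  a subspace nor how it varies. In a slice chart it becomes the image of one fixed subspace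
  \<open>S\<close> under the derivative of the inverse chart. For nearby \<open>y\<close>,
  \<open>z\<close>, the inverse chart derivative at \<open>z\<close> after the chart derivative at
  \<open>y\<close> then carries the tangent space at \<open>y\<close> to that at \<open>z\<close>
  almost without moving vectors, and this comparison controls the projections without choosing
  orthonormal frames. Its constants depend on the chart; compactness of the parameter interval makes
  them uniform along a curve. Extension by zero puts \<open>q t\<close> and \<open>p t\<close> into
  one fixed space of matrices, where they can be added and tested for absolute continuity. The price
  is paid with frames: composing with an extended map may change entries at indices beyond the
  dimension, so positivity of a frame must be shown to ignore them. All derivatives are two-sided,
  while curves are controlled only on the closed interval, so almost-everywhere statements are first
  moved to the open interval.\<close>

definition interval_family :: "real \<Rightarrow> real \<Rightarrow> nat \<Rightarrow> (nat \<Rightarrow> real) \<Rightarrow> (nat \<Rightarrow> real) \<Rightarrow> bool" where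
  "interval_family a b m u v \<longleftrightarrow> (\<forall>i<m. a \<le> u i \<and> u i \<le> v i \<and> v i \<le> b) \<and>
     (\<forall>i<m. \<forall>j<m. i \<noteq> j \<longrightarrow> {u i<..<v i} \<inter> {u j<..<v j} = {})"

lemma abs_continuous_iff:
  "abs_continuous a b f \<longleftrightarrow>
     (\<forall>\<epsilon>>0. \<exists>\<delta>>0. \<forall>(m::nat) u v. interval_family a b m u v \<and> (\<Sum>i<m. v i - u i) < \<delta>
        \<longrightarrow> (\<Sum>i<m. dist (f (u i)) (f (v i))) < \<epsilon>)"
  by (simp add: abs_continuous_def interval_family_def conj_assoc)

lemma abs_continuousE:
  assumes "abs_continuous a b f" and "\<epsilon> > 0"
  obtains \<delta> where "\<delta> > 0" and "\<forall>m u v. interval_family a b m u v \<and> (\<Sum>i<m. v i - u i) < \<delta>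
    \<longrightarrow> (\<Sum>i<m. dist (f (u i)) (f (v i))) < \<epsilon>"
proof -
  have "\<exists>\<delta>>0. \<forall>(m::nat) u v. interval_family a b m u v \<and> (\<Sum>i<m. v i - u i) < \<delta>
      \<longrightarrow> (\<Sum>i<m. dist (f (u i)) (f (v i))) < \<epsilon>"
    using assms(2) by (rule assms(1)[unfolded abs_continuous_iff, THEN spec, THEN mp])
  then show thesis
    by (elim exE conjE) (rule that)
qed

text \<open>Domination is asked only of pairs closer than \<open>\<delta>\<close>: in a family of
  total length below \<open>\<delta>\<close> every single interval is that short. This is the form
  in which local bounds can be used.\<close>

lemma abs_continuous_dominated:
  fixes f :: "real \<Rightarrow> 'a::metric_space" and h :: "real \<Rightarrow> 'b::metric_space"
  assumes h: "abs_continuous a b h" and "\<delta> > 0"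
    and dom: "\<And>s t. a \<le> s \<Longrightarrow> s \<le> t \<Longrightarrow> t \<le> b \<Longrightarrow> t - s < \<delta> \<Longrightarrow> dist (f s) (f t) \<le> C * dist (h s) (h t)"
  shows "abs_continuous a b f"
  unfolding abs_continuous_iff
proof (intro allI impI)
  fix \<epsilon> :: real assume "\<epsilon> > 0"
  \<comment> \<open>Nothing makes \<open>C\<close> positive; \<open>K\<close> is a positive bound
    for it, so that \<open>\<epsilon> / K\<close> is a legitimate tolerance for
    \<open>h\<close>.\<close>
  define K where "K = max C 0 + 1"
  have "K > 0" "C \<le> K" by (auto simp: K_def)
  have "\<epsilon> / K > 0" using \<open>\<epsilon> > 0\<close> \<open>K > 0\<close> by simp
  obtain d where "d > 0" and d: "\<forall>m u v. interval_family a b m u v \<and> (\<Sum>i<m. v i - u i) < d \<longrightarrow> (\<Sum>i<(m::nat). dist (h (u i)) (h (v i))) < \<epsilon> / K"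
    by (rule abs_continuousE[OF h \<open>\<epsilon> / K > 0\<close>]) (rule that)
  show "\<exists>\<delta>>0. \<forall>(m::nat) u v. interval_family a b m u v \<and> (\<Sum>i<m. v i - u i) < \<delta> \<longrightarrow> (\<Sum>i<m. dist (f (u i)) (f (v i))) < \<epsilon>"
  proof (intro exI[of _ "min \<delta> d"] conjI allI impI)
    show "min \<delta> d > 0" using \<open>d > 0\<close> \<open>\<delta> > 0\<close> by simp
    fix m :: nat and u v :: "nat \<Rightarrow> real"
    assume *: "interval_family a b m u v \<and> (\<Sum>i<m. v i - u i) < min \<delta> d"
    have "dist (f (u i)) (f (v i)) \<le> K * dist (h (u i)) (h (v i))" if "i < m" for i
    proof -
      have "v i - u i \<le> (\<Sum>i<m. v i - u i)"
        using * that by (intro member_le_sum) (auto simp: interval_family_def)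
      with * that have "dist (f (u i)) (f (v i)) \<le> C * dist (h (u i)) (h (v i))"
        by (intro dom) (auto simp: interval_family_def)
      also have "\<dots> \<le> K * dist (h (u i)) (h (v i))"
        using \<open>C \<le> K\<close> by (simp add: mult_right_mono)
      finally show ?thesis .
    qed
    then have "(\<Sum>i<m. dist (f (u i)) (f (v i))) \<le> K * (\<Sum>i<m. dist (h (u i)) (h (v i)))"
      unfolding sum_distrib_left by (intro sum_mono) auto
    also have "\<dots> < \<epsilon>"
      using d[rule_format, of m u v] * \<open>K > 0\<close> by (simp add: pos_less_divide_eq mult.commute)
    finally show "(\<Sum>i<m. dist (f (u i)) (f (v i))) < \<epsilon>" .
  qed
qed

lemma abs_continuous_Pair:
  assumes f: "abs_continuous a b f" and g: "abs_continuous a b g"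
  shows "abs_continuous a b (\<lambda>t. (f t, g t))"
  unfolding abs_continuous_iff
proof (intro allI impI)
  fix \<epsilon> :: real assume "\<epsilon> > 0"
  then have "\<epsilon> / 2 > 0" by simp
  obtain d where "d > 0" and d: "\<forall>m u v. interval_family a b m u v \<and> (\<Sum>i<m. v i - u i) < d \<longrightarrow> (\<Sum>i<(m::nat). dist (f (u i)) (f (v i))) < \<epsilon> / 2"
    by (rule abs_continuousE[OF f \<open>\<epsilon> / 2 > 0\<close>]) (rule that)
  obtain e where "e > 0" and e: "\<forall>m u v. interval_family a b m u v \<and> (\<Sum>i<m. v i - u i) < e \<longrightarrow> (\<Sum>i<(m::nat). dist (g (u i)) (g (v i))) < \<epsilon> / 2"
    by (rule abs_continuousE[OF g \<open>\<epsilon> / 2 > 0\<close>]) (rule that)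
  show "\<exists>\<delta>>0. \<forall>(m::nat) u v. interval_family a b m u v \<and> (\<Sum>i<m. v i - u i) < \<delta> \<longrightarrow> (\<Sum>i<m. dist (f (u i), g (u i)) (f (v i), g (v i))) < \<epsilon>"
  proof (intro exI[of _ "min d e"] conjI allI impI)
    show "min d e > 0" using \<open>d > 0\<close> \<open>e > 0\<close> by simp
    fix m :: nat and u v :: "nat \<Rightarrow> real"
    assume *: "interval_family a b m u v \<and> (\<Sum>i<m. v i - u i) < min d e"
    have "(\<Sum>i<m. dist (f (u i), g (u i)) (f (v i), g (v i)))
        \<le> (\<Sum>i<m. dist (f (u i)) (f (v i)) + dist (g (u i)) (g (v i)))"
      unfolding dist_Pair_Pair by (intro sum_mono sqrt_sum_squares_le_sum) auto
    also have "\<dots> < \<epsilon>"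
      using d[rule_format, of m u v] e[rule_format, of m u v] * by (simp add: sum.distrib)
    finally show "(\<Sum>i<m. dist (f (u i), g (u i)) (f (v i), g (v i))) < \<epsilon>" .
  qed
qed

lemma abs_continuous_imp_continuous_on:
  assumes "abs_continuous a b f"
  shows "continuous_on {a..b} f"
  unfolding continuous_on_iff
proof (intro ballI allI impI)
  fix x \<epsilon> :: real assume x: "x \<in> {a..b}" and "\<epsilon> > 0"
  obtain d where "d > 0" and d: "\<forall>m u v. interval_family a b m u v \<and> (\<Sum>i<m. v i - u i) < d \<longrightarrow> (\<Sum>i<(m::nat). dist (f (u i)) (f (v i))) < \<epsilon>"
    by (rule abs_continuousE[OF assms \<open>\<epsilon> > 0\<close>]) (rule that)
  have "dist (f y) (f x) < \<epsilon>" if "y \<in> {a..b}" "dist y x < d" for y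
  proof (cases "x \<le> y")
    case True
    then show ?thesis
      using d[rule_format, of 1 "\<lambda>_. x" "\<lambda>_. y"] x that by (auto simp: interval_family_def dist_commute dist_real_def)
  next
    case False
    then show ?thesis
      using d[rule_format, of 1 "\<lambda>_. y" "\<lambda>_. x"] x that by (auto simp: interval_family_def dist_commute dist_real_def)
  qed
  with \<open>d > 0\<close> show "\<exists>d>0. \<forall>x'\<in>{a..b}. dist x' x < d \<longrightarrow> dist (f x') (f x) < \<epsilon>"
    by blast
qed

lemma abs_continuous_cong:
  assumes "abs_continuous a b f" and "\<And>t. t \<in> {a..b} \<Longrightarrow> f t = g t"
  shows "abs_continuous a b g"
  by (rule abs_continuous_dominated[OF assms(1) zero_less_one, of _ 1])
    (use assms(2) in auto)

text \<open>Pulling the neighbourhoods back along \<open>h\<close> covers the compact interval by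
  open sets of times, each with its own constant. A finite subcover and its Lebesgue number
  \<open>\<delta>\<close> put any two times closer than \<open>\<delta>\<close> into one common
  member, so the domination criterion applies.\<close>

lemma abs_continuous_locally_lipschitz:
  fixes F :: "'a::metric_space \<Rightarrow> 'b::metric_space"
  assumes h: "abs_continuous a b h" and hM: "\<And>t. t \<in> {a..b} \<Longrightarrow> h t \<in> M"
    and loc: "\<And>x. x \<in> M \<Longrightarrow> \<exists>U C. open U \<and> x \<in> U \<and> (\<forall>y\<in>M \<inter> U. \<forall>z\<in>M \<inter> U. dist (F y) (F z) \<le> C * dist y z)"
  shows "abs_continuous a b (\<lambda>t. F (h t))"
proof -
  define lip where "lip T C \<longleftrightarrow> (\<forall>s\<in>T \<inter> {a..b}. \<forall>t\<in>T \<inter> {a..b}. dist (F (h s)) (F (h t)) \<le> C * dist (h s) (h t))"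
    for T :: "real set" and C :: real
  define G where "G = {T. open T \<and> (\<exists>C. lip T C)}"
  have cont: "continuous_on {a..b} h"
    using abs_continuous_imp_continuous_on h by blast
  have cover: "{a..b} \<subseteq> \<Union>G"
  proof
    fix t assume t: "t \<in> {a..b}"
    obtain U C where U: "open U" "h t \<in> U"
      and C: "\<forall>y\<in>M \<inter> U. \<forall>z\<in>M \<inter> U. dist (F y) (F z) \<le> C * dist y z"
      using loc[OF hM[OF t]] by (elim exE conjE) (rule that)
    obtain T where T: "open T" "T \<inter> {a..b} = h -` U \<inter> {a..b}"
      using continuous_on_open_invariant[THEN iffD1, OF cont, THEN spec, THEN mp, OF U(1)] by (elim exE conjE) (rule that)
    have "h s \<in> M \<inter> U" if "s \<in> T \<inter> {a..b}" for s
      using that[unfolded T(2)] hM by simp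
    then have "lip T C" unfolding lip_def by (intro ballI C[rule_format])
    with T(1) have "T \<in> G" unfolding G_def by auto
    moreover have "t \<in> T \<inter> {a..b}" unfolding T(2) using t U(2) by simp
    ultimately show "t \<in> \<Union>G" by blast
  qed
  have G_open: "open T" if "T \<in> G" for T using that unfolding G_def by simp
  obtain D where D: "D \<subseteq> G" "finite D" "{a..b} \<subseteq> \<Union>D"
    by (rule compactE[OF compact_Icc cover G_open])
  have D_open: "open T" if "T \<in> D" for T using that D(1) G_open by auto
  obtain \<delta> where "\<delta> > 0" and \<delta>: "\<forall>x\<in>{a..b}. \<exists>T\<in>D. ball x \<delta> \<subseteq> T"
    by (rule Heine_Borel_lemma[OF compact_Icc D(3) D_open], assumption) (rule that, assumption, rule ballI, blast)
  have "\<forall>T\<in>D. \<exists>C. lip T C"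
    using D(1) unfolding G_def by auto
  then obtain C where C: "\<forall>T\<in>D. lip T (C T)"
    by (rule bchoice[THEN exE])
  show ?thesis
  proof (rule abs_continuous_dominated[OF h \<open>\<delta> > 0\<close>])
    fix s t assume st: "a \<le> s" "s \<le> t" "t \<le> b" "t - s < \<delta>"
    then obtain T where "T \<in> D" "ball s \<delta> \<subseteq> T" using \<delta>[rule_format, of s] by auto
    moreover have "s \<in> ball s \<delta>" "t \<in> ball s \<delta>" using st \<open>\<delta> > 0\<close> by (auto simp: dist_real_def)
    ultimately have "s \<in> T \<inter> {a..b}" "t \<in> T \<inter> {a..b}" using st by auto
    with bspec[OF C \<open>T \<in> D\<close>] have "dist (F (h s)) (F (h t)) \<le> C T * dist (h s) (h t)"
      unfolding lip_def by (elim ballE) auto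
    \<comment> \<open>The sum over the finite subcover is a constant independent of
      \<open>T\<close>; absolute values are taken because a local constant may be negative.\<close>
    also have "\<dots> \<le> (\<Sum>T\<in>D. \<bar>C T\<bar>) * dist (h s) (h t)"
    proof (rule mult_right_mono)
      have "\<bar>C T\<bar> \<le> (\<Sum>T\<in>D. \<bar>C T\<bar>)"
        by (rule member_le_sum) (use \<open>T \<in> D\<close> D(2) in auto)
      then show "C T \<le> (\<Sum>T\<in>D. \<bar>C T\<bar>)" by linarith
    qed simp
    finally show "dist (F (h s)) (F (h t)) \<le> (\<Sum>T\<in>D. \<bar>C T\<bar>) * dist (h s) (h t)" .
  qed
qed

text \<open>A bounded bilinear map is Lipschitz on every unit ball of the product space, by changing
  one factor at a time, so the local criterion applies to the pair of curves. It is used below for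
  matrix products and for matrices acting on vectors.\<close>

lemma (in bounded_bilinear) abs_continuous:
  assumes "abs_continuous c d f" and "abs_continuous c d g"
  shows "abs_continuous c d (\<lambda>t. prod (f t) (g t))"
proof -
  have "abs_continuous c d (\<lambda>t. (\<lambda>(a, b). prod a b) (f t, g t))"
  proof (rule abs_continuous_locally_lipschitz[OF abs_continuous_Pair[OF assms]])
    fix x :: "'a \<times> 'b"
    obtain a b where x: "x = (a, b)" by fastforce
  obtain K where K: "\<And>a b. norm (prod a b) \<le> norm a * norm b * K" "K \<ge> 0"
    using nonneg_bounded by blast
  \<comment> \<open>Both components of any point at distance less than 1 from \<open>(a, b)\<close>
    have norm at most \<open>R\<close>.\<close>
  define R where "R = norm a + norm b + 1"
  have R: "norm y1 \<le> R" "norm y2 \<le> R" if "dist (a, b) (y1, y2) < 1" for y1 y2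
  proof -
    have "dist a y1 < 1" "dist b y2 < 1"
      using that dist_fst_le[of "(a, b)" "(y1, y2)"] dist_snd_le[of "(a, b)" "(y1, y2)"] by auto
    then show "norm y1 \<le> R" "norm y2 \<le> R"
      using norm_triangle_ineq2[of y1 a] norm_triangle_ineq2[of y2 b] norm_ge_zero[of a] norm_ge_zero[of b]
      unfolding R_def by (auto simp: dist_norm norm_minus_commute simp del: norm_ge_zero)
  qed
  have "dist (prod y1 y2) (prod z1 z2) \<le> (2 * R * K) * dist (y1, y2) (z1, z2)"
    if y: "dist (a, b) (y1, y2) < 1" and z: "dist (a, b) (z1, z2) < 1" for y1 y2 z1 z2
  proof -
    have "prod y1 y2 - prod z1 z2 = prod (y1 - z1) y2 + prod z1 (y2 - z2)"
      by (simp add: diff_left diff_right)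
    then have "norm (prod y1 y2 - prod z1 z2) \<le> norm (y1 - z1) * norm y2 * K + norm z1 * norm (y2 - z2) * K"
      by (metis K(1) norm_triangle_mono)
    also have "\<dots> \<le> dist (y1, y2) (z1, z2) * R * K + R * dist (y1, y2) (z1, z2) * K"
      using R[OF y] R[OF z] K(2) dist_fst_le[of "(y1, y2)" "(z1, z2)"] dist_snd_le[of "(y1, y2)" "(z1, z2)"]
        order_trans[OF norm_ge_zero R(1)[OF y]]
      by (intro add_mono mult_right_mono mult_mono) (auto simp: dist_norm)
    finally show ?thesis by (simp add: dist_norm algebra_simps)
  qed
  then show "\<exists>U C. open U \<and> x \<in> U \<and> (\<forall>y\<in>UNIV \<inter> U. \<forall>z\<in>UNIV \<inter> U.
      dist (case y of (a, b) \<Rightarrow> prod a b) (case z of (a, b) \<Rightarrow> prod a b) \<le> C * dist y z)"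
    unfolding x by (intro exI[of _ "ball (a, b) 1"] exI[of _ "2 * R * K"]) auto
  qed auto
  then show ?thesis by simp
qed

lemma abs_continuous_add:
  fixes f g :: "real \<Rightarrow> 'a::real_normed_vector"
  assumes "abs_continuous a b f" and "abs_continuous a b g"
  shows "abs_continuous a b (\<lambda>t. f t + g t)"
proof (rule abs_continuous_dominated[OF abs_continuous_Pair[OF assms] zero_less_one, of _ 2])
  fix s t
  show "dist (f s + g s) (f t + g t) \<le> 2 * dist (f s, g s) (f t, g t)"
    using dist_fst_le[of "(f s, g s)" "(f t, g t)"] dist_snd_le[of "(f s, g s)" "(f t, g t)"]
      dist_triangle_add[of "f s" "g s" "f t" "g t"] by simp
qed

lemma abs_continuous_diff:
  fixes f g :: "real \<Rightarrow> 'a::real_normed_vector"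
  assumes "abs_continuous a b f" and "abs_continuous a b g"
  shows "abs_continuous a b (\<lambda>t. f t - g t)"
proof -
  have "abs_continuous a b (\<lambda>t. - g t)"
    by (rule abs_continuous_dominated[OF assms(2) zero_less_one, of _ 1])
      (auto simp: dist_norm norm_minus_commute)
  from abs_continuous_add[OF assms(1) this] show ?thesis by simp
qed

lemma abs_continuous_fst:
  assumes "abs_continuous a b (\<lambda>t. (f t, g t))"
  shows "abs_continuous a b f"
  by (rule abs_continuous_dominated[OF assms zero_less_one, of _ 1])
    (use dist_fst_le in fastforce)

lemma abs_continuous_snd:
  assumes "abs_continuous a b (\<lambda>t. (f t, g t))"
  shows "abs_continuous a b g"
  by (rule abs_continuous_dominated[OF assms zero_less_one, of _ 1])
    (use dist_snd_le in fastforce)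

section \<open>Orthogonal projections\<close>

lemma orthogonal_comp_iff: "w \<in> V\<^sup>\<bottom> \<longleftrightarrow> (\<forall>v\<in>V. v \<bullet> w = 0)"
  by (auto simp: orthogonal_comp_def orthogonal_def)

lemma proj_unique:
  assumes V: "subspace V" and a: "a \<in> V" "v - a \<in> V\<^sup>\<bottom>"
  shows "proj V v = a"
  unfolding proj_def
proof (rule the_equality)
  fix b assume b: "b \<in> V \<and> v - b \<in> V\<^sup>\<bottom>"
  have "b - a \<in> V" using a b V by (simp add: subspace_diff)
  moreover have "b - a \<in> V\<^sup>\<bottom>"
    using subspace_diff[OF subspace_orthogonal_comp a(2), of "v - b"] b by simp
  ultimately have "b - a \<in> V \<inter> V\<^sup>\<bottom>" by (rule IntI)
  then show "b = a" unfolding orthogonal_Int_0[OF V] by simp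
qed (rule conjI[OF a])

lemma
  assumes V: "subspace V"
  shows proj_in: "proj V v \<in> V" and diff_proj_in: "v - proj V v \<in> V\<^sup>\<bottom>"
proof -
  have "v \<in> V + V\<^sup>\<bottom>" using subspace_sum_orthogonal_comp[OF V] by simp
  then obtain a b where "a \<in> V" "b \<in> V\<^sup>\<bottom>" "v = a + b" by (auto elim: set_plus_elim)
  then have "a \<in> V \<and> v - a \<in> V\<^sup>\<bottom>" by simp
  with proj_unique[OF V] show "proj V v \<in> V" "v - proj V v \<in> V\<^sup>\<bottom>" by auto
qed

lemma proj_id: "subspace V \<Longrightarrow> v \<in> V \<Longrightarrow> proj V v = v"
  by (rule proj_unique) (auto simp: subspace_0 subspace_orthogonal_comp)

lemma proj_zero: "subspace V \<Longrightarrow> v \<in> V\<^sup>\<bottom> \<Longrightarrow> proj V v = 0"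
  by (rule proj_unique) (auto simp: subspace_0)

lemma proj_orthogonal_comp:
  assumes "subspace V"
  shows "proj (V\<^sup>\<bottom>) v = v - proj V v"
proof (rule proj_unique)
  show "v - (v - proj V v) \<in> V\<^sup>\<bottom>\<^sup>\<bottom>"
    using proj_in[OF assms] orthogonal_comp_subset by auto
qed (auto simp: subspace_orthogonal_comp diff_proj_in assms)

lemma linear_proj:
  assumes V: "subspace V"
  shows "linear (proj V)"
proof (rule linearI)
  fix x y :: 'a and c :: real
  show "proj V (x + y) = proj V x + proj V y"
  proof (rule proj_unique[OF V])
    show "proj V x + proj V y \<in> V" by (simp add: V proj_in subspace_add)
    have "(x - proj V x) + (y - proj V y) \<in> V\<^sup>\<bottom>"
      by (intro subspace_add subspace_orthogonal_comp diff_proj_in V)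
    then show "x + y - (proj V x + proj V y) \<in> V\<^sup>\<bottom>" by (simp add: algebra_simps)
  qed
  show "proj V (c *\<^sub>R x) = c *\<^sub>R proj V x"
  proof (rule proj_unique[OF V])
    show "c *\<^sub>R proj V x \<in> V" by (simp add: V proj_in subspace_scale)
    have "c *\<^sub>R (x - proj V x) \<in> V\<^sup>\<bottom>"
      by (intro subspace_scale subspace_orthogonal_comp diff_proj_in V)
    then show "c *\<^sub>R x - c *\<^sub>R proj V x \<in> V\<^sup>\<bottom>" by (simp add: algebra_simps)
  qed
qed

lemma inner_proj:
  assumes "subspace V" shows "proj V v \<bullet> (v - proj V v) = 0"
  using proj_in[OF assms] diff_proj_in[OF assms] by (auto simp: orthogonal_comp_iff)

lemma norm_proj_sq:
  assumes "subspace V"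
  shows "(norm v)\<^sup>2 = (norm (proj V v))\<^sup>2 + (norm (v - proj V v))\<^sup>2"
proof -
  have "(norm (proj V v + (v - proj V v)))\<^sup>2 = (norm (proj V v))\<^sup>2 + (norm (v - proj V v))\<^sup>2"
    by (rule norm_add_Pythagorean) (simp add: orthogonal_def inner_proj[OF assms])
  then show ?thesis by simp
qed

lemma norm_proj_le:
  assumes "subspace V"
  shows "norm (proj V v) \<le> norm v" "norm (v - proj V v) \<le> norm v"
  by (rule power2_le_imp_le; simp add: norm_proj_sq[OF assms, of v])+

text \<open>The projection is the nearest point: subtracting \<open>a\<close> in \<open>V\<close>
  leaves the component orthogonal to \<open>V\<close> unchanged, and by Pythagoras that component is
  no longer than \<open>v - a\<close>.\<close>

lemma norm_diff_proj_le:
  assumes V: "subspace V" and a: "a \<in> V"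
  shows "norm (v - proj V v) \<le> norm (v - a)"
proof (rule power2_le_imp_le)
  have "proj V (v - a) = proj V v - a"
    by (simp add: linear_diff[OF linear_proj[OF V]] proj_id[OF V a])
  then show "(norm (v - proj V v))\<^sup>2 \<le> (norm (v - a))\<^sup>2"
    using norm_proj_sq[OF V, of "v - a"] by simp
qed simp

text \<open>With \<open>P\<close>, \<open>P'\<close> the two projections, $P - P' = (1 - P') P - P' (1 - P)$; the two closeness
  hypotheses control the two terms.\<close>

lemma proj_close:
  assumes V: "subspace V" and V': "subspace V'"
    and *: "\<And>v. v \<in> V \<Longrightarrow> \<exists>w\<in>V'. norm (v - w) \<le> k * norm v"
    and **: "\<And>w. w \<in> V' \<Longrightarrow> \<exists>v\<in>V. norm (w - v) \<le> k * norm w"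
    and "0 \<le> k"
  shows "norm (proj V e - proj V' e) \<le> 2 * k * norm e"
proof -
  have 1: "norm (proj V e - proj V' (proj V e)) \<le> k * norm e"
  proof -
    obtain w where "w \<in> V'" "norm (proj V e - w) \<le> k * norm (proj V e)"
      using *[OF proj_in[OF V]] by blast
    then have "norm (proj V e - proj V' (proj V e)) \<le> k * norm (proj V e)"
      using norm_diff_proj_le[OF V'] by (meson order_trans)
    also have "\<dots> \<le> k * norm e" using norm_proj_le[OF V] \<open>0 \<le> k\<close> by (simp add: mult_left_mono)
    finally show ?thesis .
  qed
  have 2: "norm (proj V' (e - proj V e)) \<le> k * norm e"
  proof -
    define w where "w = e - proj V e"
    define u where "u = proj V' w"
    obtain v where v: "v \<in> V" "norm (u - v) \<le> k * norm u"
      using **[OF proj_in[OF V']] unfolding u_def by blast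
    have "v \<bullet> w = 0"
      using v diff_proj_in[OF V, of e] unfolding w_def by (auto simp: orthogonal_comp_iff)
    moreover have "u \<bullet> (w - u) = 0" unfolding u_def by (rule inner_proj[OF V'])
    \<comment> \<open>Both orthogonalities act at once: \<open>u \<bullet> u = u \<bullet> w\<close>
      and \<open>v \<bullet> w = 0\<close>. Only the small vector \<open>u - v\<close> is left, and
      one factor \<open>norm u\<close> can be cancelled afterwards.\<close>
    ultimately have "norm u * norm u = (u - v) \<bullet> w"
      by (simp add: inner_diff_left inner_diff_right norm_eq_sqrt_inner)
    also have "\<dots> \<le> norm (u - v) * norm w" by (rule norm_cauchy_schwarz)
    also have "\<dots> \<le> k * norm u * norm w" using v by (simp add: mult_right_mono)
    finally have "norm u \<le> k * norm w"
      using \<open>0 \<le> k\<close> by (cases "norm u = 0") (auto simp: mult.assoc mult.left_commute[of k])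
    also have "\<dots> \<le> k * norm e" using norm_proj_le[OF V] \<open>0 \<le> k\<close> by (simp add: mult_left_mono w_def)
    finally show ?thesis by (simp add: u_def w_def)
  qed
  have "proj V e - proj V' e = (proj V e - proj V' (proj V e)) - proj V' (e - proj V e)"
    by (simp add: linear_diff[OF linear_proj[OF V']])
  then have "norm (proj V e - proj V' e) \<le> k * norm e + k * norm e"
    using 1 2 norm_triangle_ineq4 by (metis (no_types, lifting) add_mono order_trans)
  then show ?thesis by simp
qed

section \<open>Functions of class $C^k$ and slice charts\<close>

lemma Ck_on_cong:
  assumes "open S" and "\<And>x. x \<in> S \<Longrightarrow> f x = g x"
  shows "Ck_on k f S \<longleftrightarrow> Ck_on k g S"
  using assms(2)
proof (induction k arbitrary: f g)
  case 0
  then show ?case by (auto cong: continuous_on_cong)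
next
  case (Suc k)
  have der: "(f has_derivative D) (at x) \<longleftrightarrow> (g has_derivative D) (at x)" if "x \<in> S" for x D
    using that Suc.prems \<open>open S\<close>
    by (metis has_derivative_transform_within_open)
  then have "f differentiable (at x) \<longleftrightarrow> g differentiable (at x)"
    "frechet_derivative f (at x) = frechet_derivative g (at x)" if "x \<in> S" for x
    using that by (auto simp: differentiable_def frechet_derivative_def)
  with Suc.IH show ?case by (metis (no_types, lifting) Ck_on.simps(2))
qed

text \<open>Along a line no higher chain rule is required: the derivative in direction
  \<open>r\<close> is the restriction to the same line of the directional derivative of
  \<open>f\<close> along \<open>r *\<^sub>R u\<close>, to which the induction hypothesis applies.
  This gives the smooth curves that realize tangent vectors.\<close>

lemma Ck_on_line:
  fixes f :: "'a::real_normed_vector \<Rightarrow> 'b::real_normed_vector"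
  assumes "Ck_on k f W" and "open I" and "\<And>s. s \<in> I \<Longrightarrow> a + s *\<^sub>R u \<in> W"
  shows "Ck_on k (\<lambda>s::real. f (a + s *\<^sub>R u)) I"
  using assms(1)
proof (induction k arbitrary: f)
  case 0
  then have "continuous_on W f" by simp
  then show ?case
    using assms(3) by (auto intro!: continuous_intros elim!: continuous_on_compose2)
next
  case (Suc k)
  have der: "((\<lambda>s. f (a + s *\<^sub>R u)) has_derivative (\<lambda>r. frechet_derivative f (at (a + s *\<^sub>R u)) (r *\<^sub>R u))) (at s)"
    if "s \<in> I" for s
  proof -
    have "(f has_derivative frechet_derivative f (at (a + s *\<^sub>R u))) (at (a + s *\<^sub>R u))"
      using Suc.prems assms(3) that frechet_derivative_works by auto
    moreover have "((\<lambda>s. a + s *\<^sub>R u) has_derivative (\<lambda>r. r *\<^sub>R u)) (at s)"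
      by (auto intro!: derivative_eq_intros)
    ultimately show ?thesis by (rule has_derivative_compose[rotated])
  qed
  have "Ck_on k (\<lambda>s. frechet_derivative (\<lambda>s. f (a + s *\<^sub>R u)) (at s) r) I" for r
  proof -
    have "Ck_on k (\<lambda>s. frechet_derivative f (at (a + s *\<^sub>R u)) (r *\<^sub>R u)) I"
      using Suc.prems by (intro Suc.IH[where f = "\<lambda>x. frechet_derivative f (at x) (r *\<^sub>R u)"]) auto
    then show ?thesis
      by (subst Ck_on_cong[OF \<open>open I\<close>, of _ "\<lambda>s. frechet_derivative f (at (a + s *\<^sub>R u)) (r *\<^sub>R u)"])
        (auto simp flip: frechet_derivative_at[OF der])
  qed
  with der show ?case by (auto simp: differentiable_def)
qed

text \<open>\<open>Ck_on\<close> yields continuity of the derivative in each fixed direction only.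
  Bounds on the compact ball for the finitely many basis directions add up to a bound of the
  operator norm, and convexity of the ball turns this into a Lipschitz bound with the same
  constant.\<close>

lemma Ck_on_1_deriv_bound:
  fixes f :: "'a::euclidean_space \<Rightarrow> 'b::real_normed_vector"
  assumes "Ck_on 1 f W" and "cball x r \<subseteq> W"
  obtains L where "0 \<le> L" "\<And>y v. y \<in> cball x r \<Longrightarrow> norm (frechet_derivative f (at y) v) \<le> L * norm v"
    "\<And>y z. y \<in> cball x r \<Longrightarrow> z \<in> cball x r \<Longrightarrow> norm (f y - f z) \<le> L * norm (y - z)"
proof -
  let ?D = "\<lambda>y. frechet_derivative f (at y)"
  have der: "(f has_derivative ?D y) (at y)" if "y \<in> cball x r" for y
    using assms that by (auto simp flip: frechet_derivative_works)
  have "\<exists>B. \<forall>y\<in>cball x r. norm (?D y b) \<le> B" for b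
  proof -
    have "continuous_on (cball x r) (\<lambda>y. ?D y b)"
      using assms by (auto elim!: continuous_on_subset)
    then have "bounded ((\<lambda>y. ?D y b) ` cball x r)"
      by (intro compact_imp_bounded compact_continuous_image) auto
    then show ?thesis by (auto simp: bounded_iff)
  qed
  then obtain B where B: "\<And>b y. y \<in> cball x r \<Longrightarrow> norm (?D y b) \<le> B b" by metis
  define L where "L = (\<Sum>b\<in>Basis. \<bar>B b\<bar>)"
  have on: "onorm (?D y) \<le> L" if "y \<in> cball x r" for y
  proof -
    have "onorm (?D y) \<le> (\<Sum>b\<in>Basis. norm (?D y b))"
      by (rule onorm_componentwise) (use der[OF that] has_derivative_bounded_linear in auto)
    also have "\<dots> \<le> L" unfolding L_def
      using B[OF that] by (intro sum_mono) (meson abs_ge_self order_trans)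
    finally show ?thesis .
  qed
  show ?thesis
  proof
    show "0 \<le> L" by (simp add: L_def sum_nonneg)
    show "norm (?D y v) \<le> L * norm v" if "y \<in> cball x r" for y v
      using onorm[OF has_derivative_bounded_linear[OF der[OF that]], of v] on[OF that]
      by (meson mult_right_mono norm_ge_zero order_trans)
    show "norm (f y - f z) \<le> L * norm (y - z)" if "y \<in> cball x r" "z \<in> cball x r" for y z
      by (rule differentiable_bound[OF convex_cball _ on])
        (use that der has_derivative_at_withinI in blast)+
  qed
qed

text \<open>Pairing with a vector orthogonal to \<open>S\<close> gives a function that vanishes near
  \<open>t\<close>, so \<open>v\<close> is orthogonal to the complement of \<open>S\<close>; the
  double complement of \<open>S\<close> is \<open>S\<close> itself.\<close>

lemma has_vector_derivative_in_subspace: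
  fixes f :: "real \<Rightarrow> 'a::euclidean_space"
  assumes S: "subspace S" and f: "(f has_vector_derivative v) (at t)"
    and ev: "\<forall>\<^sub>F s in nhds t. f s \<in> S"
  shows "v \<in> S"
proof -
  have "w \<bullet> v = 0" if "w \<in> S\<^sup>\<bottom>" for w
  proof -
    have "((\<lambda>s. w \<bullet> f s) has_vector_derivative w \<bullet> v) (at t)"
      by (rule bounded_linear.has_vector_derivative[OF bounded_linear_inner_right f])
    moreover have "((\<lambda>s. w \<bullet> f s) has_vector_derivative 0) (at t)"
    proof -
      obtain T where T: "open T" "t \<in> T" "\<forall>s\<in>T. f s \<in> S"
        using ev unfolding eventually_nhds by blast
      have eq: "0 = w \<bullet> f s" if "s \<in> T" for s
        using T(3) \<open>w \<in> S\<^sup>\<bottom>\<close> \<open>s \<in> T\<close> by (auto simp: orthogonal_comp_iff inner_commute[of w])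
      have "((\<lambda>s. 0) has_vector_derivative 0) (at t)" by simp
      then show ?thesis
        by (rule has_vector_derivative_transform_within_open[OF _ T(1,2)]) (rule eq)
    qed
    ultimately show ?thesis by (rule vector_derivative_unique_at)
  qed
  then have "v \<in> S\<^sup>\<bottom>\<^sup>\<bottom>" by (simp add: orthogonal_comp_iff)
  then show ?thesis by (simp add: orthogonal_comp_self S)
qed

section \<open>Tangent spaces and their orthogonal projections in a slice chart\<close>

locale slice_chart =
  fixes M :: "'v::euclidean_space set" and U W S :: "'v set" and \<phi> \<psi> :: "'v \<Rightarrow> 'v"
  assumes open_U: "open U" and open_W: "open W"
    and homeo: "homeomorphism U W \<phi> \<psi>"
    and smooth_\<phi>: "smooth_on \<phi> U" and smooth_\<psi>: "smooth_on \<psi> W"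
    and S: "subspace S" and slice: "\<phi> ` (M \<inter> U) = S \<inter> W"
begin

definition D where "D y = frechet_derivative \<phi> (at y)"
text \<open>Indexing by the point of \<open>U\<close> rather than by its image in \<open>W\<close>
  makes \<open>D y\<close> and \<open>E y\<close> mutually inverse.\<close>

definition E where "E y = frechet_derivative \<psi> (at (\<phi> y))"

lemma \<psi>_\<phi>: "y \<in> U \<Longrightarrow> \<psi> (\<phi> y) = y" and \<phi>_\<psi>: "z \<in> W \<Longrightarrow> \<phi> (\<psi> z) = z"
  and \<phi>_in: "y \<in> U \<Longrightarrow> \<phi> y \<in> W" and \<psi>_in: "z \<in> W \<Longrightarrow> \<psi> z \<in> U"
  using homeo by (auto simp: homeomorphism_def)

lemma Ck_\<phi>: "Ck_on k \<phi> U" and Ck_\<psi>: "Ck_on k \<psi> W"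
  using smooth_\<phi> smooth_\<psi> by (auto simp: smooth_on_def)

lemma der_\<phi>: "y \<in> U \<Longrightarrow> (\<phi> has_derivative D y) (at y)"
  using Ck_\<phi>[of 1] unfolding D_def by (auto simp flip: frechet_derivative_works)

lemma der_\<psi>: "y \<in> U \<Longrightarrow> (\<psi> has_derivative E y) (at (\<phi> y))"
  using Ck_\<psi>[of 1] \<phi>_in unfolding E_def by (auto simp flip: frechet_derivative_works)

lemma linear_E: "y \<in> U \<Longrightarrow> linear (E y)"
  by (rule has_derivative_linear, erule der_\<psi>)

lemma E_D: assumes "y \<in> U" shows "E y (D y v) = v"
proof -
  have "((\<lambda>y. \<psi> (\<phi> y)) has_derivative (\<lambda>v. E y (D y v))) (at y)"
    by (rule has_derivative_compose[OF der_\<phi>[OF assms] der_\<psi>[OF assms]])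
  then have "((\<lambda>y. y) has_derivative (\<lambda>v. E y (D y v))) (at y)"
    by (rule has_derivative_transform_within_open[OF _ open_U assms]) (rule \<psi>_\<phi>)
  from has_derivative_unique[OF this has_derivative_ident] show ?thesis by (simp add: fun_eq_iff)
qed

lemma D_E: assumes "y \<in> U" shows "D y (E y u) = u"
proof -
  have "(\<phi> has_derivative D y) (at (\<psi> (\<phi> y)))"
    by (simp add: \<psi>_\<phi> assms der_\<phi>)
  then have "((\<lambda>z. \<phi> (\<psi> z)) has_derivative (\<lambda>v. D y (E y v))) (at (\<phi> y))"
    by (rule has_derivative_compose[OF der_\<psi>[OF assms]])
  then have "((\<lambda>y. y) has_derivative (\<lambda>v. D y (E y v))) (at (\<phi> y))"
    by (rule has_derivative_transform_within_open[OF _ open_W \<phi>_in[OF assms]]) (rule \<phi>_\<psi>)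
  from has_derivative_unique[OF this has_derivative_ident] show ?thesis by (simp add: fun_eq_iff)
qed

text \<open>Near \<open>t\<close> the curve read in the chart runs in the subspace \<open>S\<close>,
  hence so does its velocity. Differentiability at the single point \<open>t\<close> is enough, so
  this covers the smooth curves of \<open>tangent_space\<close> as well as absolutely continuous
  ones.\<close>

lemma D_velocity:
  assumes \<gamma>: "(\<gamma> has_vector_derivative v) (at t)" and M: "\<forall>\<^sub>F s in nhds t. \<gamma> s \<in> M" and U: "\<gamma> t \<in> U"
  shows "D (\<gamma> t) v \<in> S"
proof (rule has_vector_derivative_in_subspace[OF S])
  show "((\<phi> \<circ> \<gamma>) has_vector_derivative D (\<gamma> t) v) (at t)"
    by (rule vector_derivative_diff_chain_within[OF \<gamma> has_derivative_at_withinI[OF der_\<phi>[OF U]]])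
  have "isCont \<gamma> t"
    using \<gamma> has_vector_derivative_continuous by blast
  then have "(\<gamma> \<longlongrightarrow> \<gamma> t) (nhds t)"
    by (simp add: continuous_at tendsto_nhds_iff isCont_def)
  then have "\<forall>\<^sub>F s in nhds t. \<gamma> s \<in> U"
    using open_U U by (rule topological_tendstoD)
  with M show "\<forall>\<^sub>F s in nhds t. (\<phi> \<circ> \<gamma>) s \<in> S"
    by eventually_elim (use slice in auto)
qed

text \<open>A tangent vector is read in the chart as a vector of \<open>S\<close>, and
  \<open>E y\<close> undoes this reading. Conversely \<open>E y u\<close> is the velocity of the
  image under \<psi> of the straight segment through \<open>\<phi> y\<close> in direction
  \<open>u\<close>, which stays in the slice for short times.\<close>

lemma tangent_space_eq:
  assumes y: "y \<in> M \<inter> U"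
  shows "tangent_space M y = E y ` S"
proof (intro equalityI subsetI)
  fix v assume "v \<in> tangent_space M y"
  then obtain \<gamma> e where \<gamma>: "e > 0" "\<gamma> ` {-e<..<e} \<subseteq> M" "\<gamma> 0 = y" "(\<gamma> has_vector_derivative v) (at 0)"
    unfolding tangent_space_def by blast
  have "\<forall>\<^sub>F s in nhds (0::real). s \<in> {-e<..<e}"
    by (rule eventually_nhds_in_open) (use \<gamma>(1) in auto)
  then have "\<forall>\<^sub>F s in nhds 0. \<gamma> s \<in> M"
    by eventually_elim (use \<gamma>(2) in blast)
  then have "D y v \<in> S"
    using D_velocity[OF \<gamma>(4)] \<gamma>(3) y by simp
  then show "v \<in> E y ` S"
    using E_D[of y v] y by (metis IntD2 imageI)
next
  fix v assume "v \<in> E y ` S"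
  then obtain u where u: "u \<in> S" "v = E y u" by blast
  define \<gamma> where "\<gamma> s = \<psi> (\<phi> y + s *\<^sub>R u)" for s
  have "open ((\<lambda>s. \<phi> y + s *\<^sub>R u) -` W)"
    by (rule open_vimage[OF open_W]) (intro continuous_intros)
  moreover have "0 \<in> (\<lambda>s. \<phi> y + s *\<^sub>R u) -` W" using y \<phi>_in by simp
  ultimately obtain e where e: "e > 0" "ball 0 e \<subseteq> (\<lambda>s. \<phi> y + s *\<^sub>R u) -` W"
    by (rule openE)
  have W: "\<phi> y + s *\<^sub>R u \<in> W" if "s \<in> {-e<..<e}" for s
    using subsetD[OF e(2), of s] that by (simp add: dist_real_def abs_less_iff)
  have "smooth_on \<gamma> {-e<..<e}"
    unfolding smooth_on_def \<gamma>_def by (intro allI Ck_on_line[OF Ck_\<psi>] open_greaterThanLessThan W)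
  moreover have "\<gamma> s \<in> M" if "s \<in> {-e<..<e}" for s
  proof -
    have "\<phi> y \<in> S" using slice y by auto
    then have "\<phi> y + s *\<^sub>R u \<in> S \<inter> W"
      using W[OF that] u(1) S by (auto intro: subspace_add subspace_scale)
    then obtain z where "z \<in> M \<inter> U" "\<phi> y + s *\<^sub>R u = \<phi> z"
      unfolding slice[symmetric] by blast
    then show ?thesis by (simp add: \<gamma>_def \<psi>_\<phi>)
  qed
  moreover have "\<gamma> 0 = y" using y by (simp add: \<gamma>_def \<psi>_\<phi>)
  moreover have "(\<gamma> has_vector_derivative v) (at 0)"
  proof -
    have "((\<lambda>s. \<phi> y + s *\<^sub>R u) has_derivative (\<lambda>s. s *\<^sub>R u)) (at (0::real))"
      by (auto intro!: derivative_eq_intros)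
    moreover have "(\<psi> has_derivative E y) (at (\<phi> y + 0 *\<^sub>R u))"
      using der_\<psi> y by simp
    ultimately have "(\<gamma> has_derivative (\<lambda>s. E y (s *\<^sub>R u))) (at 0)"
      unfolding \<gamma>_def by (rule has_derivative_compose)
    then show ?thesis
      using linear_E y u(2) by (simp add: has_vector_derivative_def linear_scale)
  qed
  ultimately show "v \<in> tangent_space M y"
    unfolding tangent_space_def using e(1) by blast
qed

lemma subspace_tangent: "y \<in> M \<inter> U \<Longrightarrow> subspace (tangent_space M y)"
  by (simp add: tangent_space_eq linear_E S linear_subspace_image)

text \<open>A vector \<open>v = E y (D y v)\<close> tangent at \<open>y\<close> is compared with
  \<open>E z (D y v)\<close>, tangent at \<open>z\<close>; the error is \<open>E y - E z\<close>
  applied to \<open>D y v\<close>. Here \<open>L\<close> bounds \<open>D\<close> and is a Lipschitz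
  constant of \<phi>, while \<open>B\<close> is one for the derivative of \<psi>, so
  \<open>E\<close> varies at rate \<open>B * L\<close> and the error at rate
  \<open>B * L * L\<close>. The comparison is symmetric in \<open>y\<close> and \<open>z\<close>,
  which is what \<open>proj_close\<close> asks for; that lemma contributes the factor 2.\<close>

lemma proj_tangent_lipschitz:
  assumes x: "x \<in> U"
  obtains r C where "r > 0"
    "\<And>y z e. y \<in> M \<inter> ball x r \<Longrightarrow> z \<in> M \<inter> ball x r \<Longrightarrow>
       norm (proj (tangent_space M y) e - proj (tangent_space M z) e) \<le> C * dist y z * norm e"
proof -
  obtain r1 where r1: "r1 > 0" "cball x r1 \<subseteq> U"
    using open_contains_cball open_U x by blast
  obtain r2 where r2: "r2 > 0" "cball (\<phi> x) r2 \<subseteq> W"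
    using open_contains_cball open_W \<phi>_in[OF x] by blast
  obtain L where L: "0 \<le> L" "\<And>y v. y \<in> cball x r1 \<Longrightarrow> norm (D y v) \<le> L * norm v"
    "\<And>y z. y \<in> cball x r1 \<Longrightarrow> z \<in> cball x r1 \<Longrightarrow> norm (\<phi> y - \<phi> z) \<le> L * norm (y - z)"
    using Ck_on_1_deriv_bound[OF Ck_\<phi> r1(2)] unfolding D_def by metis
  have "\<exists>K\<ge>0. \<forall>y\<in>cball (\<phi> x) r2. \<forall>z\<in>cball (\<phi> x) r2.
      norm (frechet_derivative \<psi> (at y) b - frechet_derivative \<psi> (at z) b) \<le> K * norm (y - z)" for b
  proof -
    \<comment> \<open>Second derivatives of the chart enter here: each directional derivative of
      \<psi> is itself of class C^1 and therefore Lipschitz on the closed ball.\<close>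
    have "Ck_on 1 (\<lambda>z. frechet_derivative \<psi> (at z) b) W"
      using Ck_\<psi>[of "Suc 1"] unfolding Ck_on.simps(2)[of 1] by blast
    from Ck_on_1_deriv_bound[OF this r2(2)] show ?thesis by metis
  qed
  then obtain K where K: "\<And>b. K b \<ge> 0" "\<And>b y z. y \<in> cball (\<phi> x) r2 \<Longrightarrow> z \<in> cball (\<phi> x) r2 \<Longrightarrow>
      norm (frechet_derivative \<psi> (at y) b - frechet_derivative \<psi> (at z) b) \<le> K b * norm (y - z)"
    by metis
  define B where "B = (\<Sum>b\<in>Basis. K b)"
  have "B \<ge> 0" unfolding B_def by (simp add: K(1) sum_nonneg)
  \<comment> \<open>The first bound keeps points inside \<open>U\<close>; the second keeps their
    chart images within \<open>r2\<close> of \<open>\<phi> x\<close>, as \<phi> is Lipschitz with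
    constant \<open>L\<close>. Using \<open>L + 1\<close> avoids dividing by zero.\<close>
  define r where "r = min r1 (r2 / (L + 1))"
  have "r > 0" using r1 r2 L(1) by (simp add: r_def)
  have U: "y \<in> cball x r1" "\<phi> y \<in> cball (\<phi> x) r2" "y \<in> U" if "y \<in> ball x r" for y
  proof -
    show y1: "y \<in> cball x r1" using that by (simp add: r_def)
    then show "y \<in> U" using r1(2) by blast
    have "norm (\<phi> x - \<phi> y) \<le> L * norm (x - y)" using L(3)[of x y] y1 r1(1) by simp
    also have "\<dots> \<le> (L + 1) * norm (x - y)" by (simp add: mult_right_mono)
    also have "\<dots> \<le> (L + 1) * (r2 / (L + 1))"
      using that L(1) by (intro mult_left_mono) (auto simp: r_def dist_norm)
    also have "\<dots> = r2" using L(1) by simp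
    finally show "\<phi> y \<in> cball (\<phi> x) r2" by (simp add: dist_norm)
  qed
  have E: "norm (E y u - E z u) \<le> B * L * dist y z * norm u"
    if y: "y \<in> ball x r" and z: "z \<in> ball x r" for y z u
  proof -
    have expand: "E y' u = (\<Sum>b\<in>Basis. (u \<bullet> b) *\<^sub>R E y' b)" if "y' \<in> ball x r" for y'
    proof -
      have "E y' u = E y' (\<Sum>b\<in>Basis. (u \<bullet> b) *\<^sub>R b)" by (simp add: euclidean_representation)
      also have "\<dots> = (\<Sum>b\<in>Basis. (u \<bullet> b) *\<^sub>R E y' b)"
        using linear_E[OF U(3)[OF that]] by (simp add: linear_sum linear_scale)
      finally show ?thesis .
    qed
    have "norm (E y u - E z u) = norm (\<Sum>b\<in>Basis. (u \<bullet> b) *\<^sub>R (E y b - E z b))"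
      unfolding expand[OF y] expand[OF z] by (simp add: sum_subtractf scaleR_diff_right)
    also have "\<dots> \<le> (\<Sum>b\<in>Basis. norm ((u \<bullet> b) *\<^sub>R (E y b - E z b)))" by (rule norm_sum)
    also have "\<dots> \<le> (\<Sum>b\<in>Basis. norm u * (K b * (L * dist y z)))"
    proof (rule sum_mono)
      fix b :: 'v assume b: "b \<in> Basis"
      have "norm (E y b - E z b) \<le> K b * norm (\<phi> y - \<phi> z)"
        unfolding E_def using K(2) U(2) y z by blast
      also have "\<dots> \<le> K b * (L * dist y z)"
        using L(3) U(1) y z K(1) by (simp add: dist_norm mult_left_mono)
      finally show "norm ((u \<bullet> b) *\<^sub>R (E y b - E z b)) \<le> norm u * (K b * (L * dist y z))"
        using Basis_le_norm[OF b, of u] by (auto intro!: mult_mono)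
    qed
    also have "\<dots> = B * L * dist y z * norm u"
      unfolding B_def sum_distrib_right by (rule sum.cong) auto
    finally show ?thesis .
  qed
  have close: "\<exists>w\<in>tangent_space M z. norm (v - w) \<le> (B * L * L * dist y z) * norm v"
    if y: "y \<in> M \<inter> ball x r" and z: "z \<in> M \<inter> ball x r" and v: "v \<in> tangent_space M y" for y z v
  proof (rule bexI)
    have yU: "y \<in> M \<inter> U" and zU: "z \<in> M \<inter> U" using y z U by auto
    obtain u where u: "u \<in> S" "v = E y u" using v tangent_space_eq[OF yU] by blast
    then have Dv: "D y v = u" using D_E yU by auto
    show "E z (D y v) \<in> tangent_space M z"
      unfolding Dv tangent_space_eq[OF zU] using u(1) by (rule imageI)
    have "norm (v - E z (D y v)) \<le> B * L * dist y z * norm (D y v)"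
      unfolding Dv unfolding u(2) using E y z by blast
    also have "\<dots> \<le> B * L * dist y z * (L * norm v)"
      using L(1,2) U(1) y \<open>B \<ge> 0\<close> by (intro mult_left_mono) auto
    finally show "norm (v - E z (D y v)) \<le> (B * L * L * dist y z) * norm v" by (simp add: algebra_simps)
  qed
  show ?thesis
  proof (rule that[OF \<open>r > 0\<close>])
    fix y z e assume y: "y \<in> M \<inter> ball x r" and z: "z \<in> M \<inter> ball x r"
    have "norm (proj (tangent_space M y) e - proj (tangent_space M z) e) \<le> 2 * (B * L * L * dist y z) * norm e"
    proof (rule proj_close)
      show "subspace (tangent_space M y)" "subspace (tangent_space M z)"
        using subspace_tangent y z U(3) by auto
      show "\<exists>w\<in>tangent_space M z. norm (v - w) \<le> (B * L * L * dist y z) * norm v"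
        if "v \<in> tangent_space M y" for v using close[OF y z that] .
      show "\<exists>v\<in>tangent_space M y. norm (w - v) \<le> (B * L * L * dist y z) * norm w"
        if "w \<in> tangent_space M z" for w using close[OF z y that] by (simp add: dist_commute)
      show "0 \<le> B * L * L * dist y z" using \<open>B \<ge> 0\<close> L(1) by simp
    qed
    then show "norm (proj (tangent_space M y) e - proj (tangent_space M z) e) \<le> (2 * B * L * L) * dist y z * norm e"
      by (simp add: mult.assoc)
  qed
qed

end

lemma embedded_submanifold_chart:
  assumes "embedded_submanifold n M" and "x \<in> M"
  obtains U W \<phi> \<psi> S where "slice_chart M U W S \<phi> \<psi>" "x \<in> U"
proof -
  obtain U W \<phi> \<psi> S where "open U \<and> x \<in> U \<and> open (W :: 'a set) \<and>
        homeomorphism U W \<phi> \<psi> \<and> smooth_on \<phi> U \<and> smooth_on \<psi> W \<and>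
        subspace S \<and> dim S = n \<and> \<phi> ` (M \<inter> U) = S \<inter> W"
    using bspec[OF assms(1)[unfolded embedded_submanifold_def] assms(2)] by (elim exE) (rule that)
  then show thesis
    by (intro that[of U W S \<phi> \<psi>]) (simp_all add: slice_chart_def)
qed

lemma subspace_tangent_space:
  assumes "embedded_submanifold n M" and "x \<in> M"
  shows "subspace (tangent_space M x)"
proof -
  obtain U W \<phi> \<psi> S where "slice_chart M U W S \<phi> \<psi>" "x \<in> U"
    using embedded_submanifold_chart[OF assms] .
  then show ?thesis using slice_chart.subspace_tangent assms(2) by blast
qed

text \<open>The base curve of a rolling is merely differentiable almost everywhere, so its velocity
  is not tangent by definition; the chart shows that it is.\<close>

lemma velocity_in_tangent_space:
  assumes M: "embedded_submanifold n M"
    and \<gamma>: "(\<gamma> has_vector_derivative v) (at t)" and ev: "\<forall>\<^sub>F s in nhds t. \<gamma> s \<in> M"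
  shows "v \<in> tangent_space M (\<gamma> t)"
proof -
  have x: "\<gamma> t \<in> M" using eventually_nhds_x_imp_x[OF ev] .
  obtain U W \<phi> \<psi> S where *: "slice_chart M U W S \<phi> \<psi>" and U: "\<gamma> t \<in> U"
    using embedded_submanifold_chart[OF M x] .
  interpret slice_chart M U W S \<phi> \<psi> by fact
  have "D (\<gamma> t) v \<in> S" by (rule D_velocity[OF \<gamma> ev U])
  then show ?thesis
    using tangent_space_eq[of "\<gamma> t"] x U E_D[OF U, of v] by (metis IntI imageI)
qed

lemma proj_tangent_space_locally_lipschitz:
  assumes "embedded_submanifold n M" and "x \<in> M"
  obtains r C where "r > 0"
    "\<And>y z e. y \<in> M \<inter> ball x r \<Longrightarrow> z \<in> M \<inter> ball x r \<Longrightarrow>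
       norm (proj (tangent_space M y) e - proj (tangent_space M z) e) \<le> C * dist y z * norm e"
proof -
  obtain U W \<phi> \<psi> S where *: "slice_chart M U W S \<phi> \<psi>" and U: "x \<in> U"
    using embedded_submanifold_chart[OF assms] .
  show thesis by (rule slice_chart.proj_tangent_lipschitz[OF * U]) (rule that)
qed

section \<open>Frames and orientations\<close>

lemma dim_orthogonal_comp:
  fixes V :: "('k::finite) euc set"
  assumes "subspace V"
  shows "dim V + dim (V\<^sup>\<bottom>) = CARD('k)"
  using dim_subspace_orthogonal_to_vectors[OF assms subspace_UNIV]
  by (simp add: orthogonal_comp_def)

lemma is_frame_cong:
  assumes "\<And>i. i < dim V \<Longrightarrow> b i = c i"
  shows "is_frame V b \<longleftrightarrow> is_frame V c"
proof -
  have "b ` {..<dim V} = c ` {..<dim V}" "inj_on b {..<dim V} \<longleftrightarrow> inj_on c {..<dim V}"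
    by (rule image_cong inj_on_cong; use assms in simp)+
  then show ?thesis by (simp add: is_frame_def)
qed

lemma is_frame_in: "is_frame V b \<Longrightarrow> i < dim V \<Longrightarrow> b i \<in> V"
  unfolding is_frame_def by (metis imageI lessThan_iff span_base)

lemma is_frame_image:
  assumes L: "linear L" "inj_on L V" and V: "subspace V" and b: "is_frame V b"
  shows "is_frame (L ` V) (L \<circ> b)" and "dim (L ` V) = dim V"
proof -
  have span: "span (b ` {..<dim V}) = V" using b by (simp add: is_frame_def)
  show dim: "dim (L ` V) = dim V"
    by (rule dim_image_eq[OF L(1)]) (simp only: span_eq_iff[THEN iffD2, OF V] L(2))
  have "b ` {..<dim V} \<subseteq> V" using is_frame_in[OF b] by auto
  then have "inj_on (L \<circ> b) {..<dim V}"
    using b L(2) by (auto simp: is_frame_def intro: comp_inj_on inj_on_subset)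
  moreover have "independent (L ` b ` {..<dim V})"
    using b L unfolding span by (intro linear_independent_injective_image) (auto simp: is_frame_def span)
  moreover have "span (L ` b ` {..<dim V}) = L ` V"
    using linear_span_image[OF L(1)] span by simp
  ultimately show "is_frame (L ` V) (L \<circ> b)"
    unfolding is_frame_def dim by (simp add: image_comp)
qed

lemma is_frame_exists:
  assumes "subspace V"
  obtains b where "is_frame V b"
proof -
  obtain B where B: "B \<subseteq> V" "independent B" "V \<subseteq> span B" "card B = dim V"
    by (rule basis_exists)
  have fin: "finite B" using B(2) by (rule independent_imp_finite)
  then obtain b where b: "bij_betw b {0..<card B} B" using ex_bij_betw_nat_finite by blast
  have "span B = V" using B(1,3) assms by (simp add: span_minimal subset_antisym)
  then have "is_frame V b"
    using b B(2,4) by (simp add: is_frame_def bij_betw_def lessThan_atLeast0)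
  then show thesis by (rule that)
qed

text \<open>The identity serves as change of basis. The lemma is wanted because passing from a map
  to its extension by zero can alter a transported frame at indices beyond the dimension.\<close>

lemma is_orientation_cong:
  assumes Or: "is_orientation V Or" and b: "is_frame V b" and eq: "\<And>i. i < dim V \<Longrightarrow> b i = c i"
  shows "b \<in> Or \<longleftrightarrow> c \<in> Or"
proof -
  have "same_oriented V b c"
    unfolding same_oriented_def by (rule exI[of _ id]) (use eq in \<open>auto simp: matrix_id_mat_1 linear_id\<close>)
  moreover have "is_frame V c" using b is_frame_cong eq by blast
  ultimately show ?thesis using Or b unfolding is_orientation_def by blast
qed

section \<open>Determinants of ambient frames and the induced normal orientation\<close>

definition frame_matrix :: "('k::{finite,linorder}) euc frame \<Rightarrow> ((real, 'k) vec, 'k) vec" where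
  "frame_matrix b = (\<chi> i. b (card {j. j < i}))"

lemma std_positive_iff: "std_positive b \<longleftrightarrow> det (frame_matrix b) > 0"
  by (simp add: std_positive_def frame_matrix_def)

lemma card_less_bij: "bij_betw (\<lambda>i::'k::{finite,linorder}. card {j. j < i}) UNIV {..<CARD('k)}"
proof -
  have lt: "card {j. j < i} < card {j. j < k}" if "i < k" for i k :: 'k
    by (rule psubset_card_mono) (use that in auto)
  then have inj: "inj (\<lambda>i::'k. card {j. j < i})"
    by (metis (mono_tags, lifting) injI nat_neq_iff neqE)
  have "card {j. j < i} < CARD('k)" for i :: 'k
    by (rule psubset_card_mono) auto
  then have "range (\<lambda>i::'k. card {j. j < i}) \<subseteq> {..<CARD('k)}" by auto
  then have "range (\<lambda>i::'k. card {j. j < i}) = {..<CARD('k)}"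
    by (intro card_subset_eq) (auto simp: card_image[OF inj])
  with inj show ?thesis by (simp add: bij_betw_def)
qed

lemma frame_matrix_cong:
  fixes b c :: "('k::{finite,linorder}) euc frame"
  assumes "\<And>i. i < CARD('k) \<Longrightarrow> b i = c i"
  shows "frame_matrix b = frame_matrix c"
proof -
  have "card {j. j < i} < CARD('k)" for i :: 'k
    using bij_betwE[OF card_less_bij] by auto
  then show ?thesis by (simp add: frame_matrix_def assms)
qed

text \<open>Frame vectors are the rows of \<open>frame_matrix\<close>, so applying \<open>L\<close>
  to them multiplies on the right by the transpose of \<open>matrix L\<close>, which has the same
  determinant.\<close>

lemma det_frame_matrix_comp:
  assumes "linear L"
  shows "det (frame_matrix (L \<circ> b)) = det (matrix L) * det (frame_matrix b)"
proof -
  have "L x $ j = (\<Sum>k\<in>UNIV. x $ k * matrix L $ j $ k)" for x j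
  proof -
    have "L x $ j = (matrix L *v x) $ j" by (simp add: assms matrix_vector_mul)
    then show ?thesis by (simp add: matrix_vector_mult_def mult.commute)
  qed
  then have "frame_matrix (L \<circ> b) = frame_matrix b ** transpose (matrix L)"
    by (simp add: frame_matrix_def matrix_matrix_mult_def transpose_def vec_eq_iff)
  then show ?thesis by (simp add: det_mul det_transpose)
qed

text \<open>A vector in the kernel is orthogonal to every frame vector, hence to their span; as this
  is the whole space, it is orthogonal to itself.\<close>

lemma det_frame_matrix_nonzero:
  fixes b :: "('k::{finite,linorder}) euc frame"
  assumes "span (b ` {..<CARD('k)}) = UNIV"
  shows "det (frame_matrix b) \<noteq> 0"
proof -
  have "u = 0" if u: "frame_matrix b *v u = 0" for u
  proof -
    have orth: "b (card {j. j < i}) \<bullet> u = 0" for i :: 'k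
      using arg_cong[OF u, of "\<lambda>v. v $ i"] by (simp add: matrix_vector_mul_component frame_matrix_def)
    have orth': "orthogonal u x" if "x \<in> b ` {..<CARD('k)}" for x
    proof -
      have "x \<in> b ` range (\<lambda>i::'k. card {j. j < i})"
        using that unfolding bij_betw_imp_surj_on[OF card_less_bij[where 'k = 'k]] .
      then obtain i :: 'k where "x = b (card {j. j < i})" by blast
      then show ?thesis using orth by (simp add: orthogonal_def inner_commute)
    qed
    have "u \<in> span (b ` {..<CARD('k)})" by (simp add: assms)
    then have "orthogonal u u" by (rule orthogonal_to_span) (rule orth')
    then show ?thesis by (simp add: orthogonal_self)
  qed
  then have "inj ((*v) (frame_matrix b))"
    using matrix_left_invertible_ker matrix_left_invertible_injective by blast
  then show ?thesis
    using invertible_det_nz invertible_left_inverse matrix_left_invertible_injective by blast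
qed

lemma append_frame_comp: "append_frame d (L \<circ> v) (L \<circ> w) = L \<circ> append_frame d v w"
  by (auto simp: append_frame_def)

lemma append_frame_cong:
  fixes V :: "('k::{finite,linorder}) euc set" and v w v' w' :: "('k::{finite,linorder}) euc frame"
  assumes V: "subspace V" and "\<And>i. i < dim V \<Longrightarrow> v i = v' i" and "\<And>i. i < dim (V\<^sup>\<bottom>) \<Longrightarrow> w i = w' i"
  shows "frame_matrix (append_frame (dim V) v w) = frame_matrix (append_frame (dim V) v' w')"
  by (rule frame_matrix_cong) (use dim_orthogonal_comp[OF V] assms in \<open>auto simp: append_frame_def\<close>)

lemma det_append_frame_nonzero:
  fixes V :: "('k::{finite,linorder}) euc set"
  assumes V: "subspace V" and v: "is_frame V v" and w: "is_frame (V\<^sup>\<bottom>) w"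
  shows "det (frame_matrix (append_frame (dim V) v w)) \<noteq> 0"
proof (rule det_frame_matrix_nonzero)
  let ?b = "append_frame (dim V) v w" and ?A = "append_frame (dim V) v w ` {..<CARD('k)}"
  have "v ` {..<dim V} \<subseteq> ?A"
  proof (rule image_subsetI)
    fix i assume "i \<in> {..<dim V}"
    then show "v i \<in> ?A"
      using dim_orthogonal_comp[OF V] by (intro image_eqI[of _ _ i]) (auto simp: append_frame_def)
  qed
  then have 1: "V \<subseteq> span ?A" using v span_mono unfolding is_frame_def by metis
  have "w ` {..<dim (V\<^sup>\<bottom>)} \<subseteq> ?A"
  proof (rule image_subsetI)
    fix i assume "i \<in> {..<dim (V\<^sup>\<bottom>)}"
    then show "w i \<in> ?A"
      using dim_orthogonal_comp[OF V] by (intro image_eqI[of _ _ "dim V + i"]) (auto simp: append_frame_def)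
  qed
  then have 2: "V\<^sup>\<bottom> \<subseteq> span ?A" using w span_mono unfolding is_frame_def by metis
  have "x \<in> span ?A" for x
  proof -
    have "proj V x + (x - proj V x) \<in> span ?A"
      using 1 2 proj_in[OF V] diff_proj_in[OF V] by (intro span_add) auto
    then show ?thesis by simp
  qed
  then show "span ?A = UNIV" by blast
qed

lemma frame_change_exists:
  assumes V: "subspace V" and b: "is_frame V b" and c: "is_frame V c"
  obtains L where "linear L" "\<forall>i<dim V. L (b i) = c i" "\<forall>w\<in>V\<^sup>\<bottom>. L w = w"
proof -
  have inj: "inj_on b {..<dim V}" and ind: "independent (b ` {..<dim V})"
    using b by (auto simp: is_frame_def)
  obtain f where f: "linear f" "\<forall>x\<in>b ` {..<dim V}. f x = c (inv_into {..<dim V} b x)"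
    using linear_independent_extend[OF ind, of "\<lambda>x. c (inv_into {..<dim V} b x)"] by blast
  \<comment> \<open>Off the span of the frame \<open>b\<close> the extension \<open>f\<close> is
    uncontrolled. Projecting first keeps only its values on \<open>V\<close>, and the remaining
    component is passed on unchanged.\<close>
  define L where "L x = f (proj V x) + (x - proj V x)" for x
  show thesis
  proof
    show "linear L"
      unfolding L_def
      by (intro linear_compose_add linear_compose_sub linear_ident linear_proj[OF V]
          linear_compose[OF linear_proj[OF V] f(1), unfolded o_def])
    show "\<forall>i<dim V. L (b i) = c i"
    proof (intro allI impI)
      fix i assume that: "i < dim V"
      have "f (b i) = c i" using f(2) that inv_into_f_f[OF inj, of i] by simp
      then show "L (b i) = c i" unfolding L_def using is_frame_in[OF b that] by (simp add: proj_id[OF V])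
    qed
    show "\<forall>w\<in>V\<^sup>\<bottom>. L w = w"
      unfolding L_def by (simp add: proj_zero[OF V] linear_0[OF f(1)])
  qed
qed

text \<open>A change of basis on \<open>V\<close> that fixes the complement pointwise carries the
  ambient frame \<open>v\<close>, \<open>w\<close> to \<open>v'\<close>, \<open>w\<close>. Its
  determinant is thus the quotient of the two frame determinants, and its sign compares
  theirs.\<close>

lemma same_oriented_iff_std_positive:
  fixes V :: "('k::{finite,linorder}) euc set"
  assumes V: "subspace V" and v: "is_frame V v" and v': "is_frame V v'" and w: "is_frame (V\<^sup>\<bottom>) w"
  shows "same_oriented V v v' \<longleftrightarrow>
    (std_positive (append_frame (dim V) v w) \<longleftrightarrow> std_positive (append_frame (dim V) v' w))"
proof -
  let ?d = "\<lambda>u. det (frame_matrix (append_frame (dim V) u w))"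
  have det: "?d v' = det (matrix L) * ?d v"
    if L: "linear L" "\<forall>i<dim V. L (v i) = v' i" "\<forall>x\<in>V\<^sup>\<bottom>. L x = x" for L
  proof -
    have "frame_matrix (append_frame (dim V) v' w) = frame_matrix (append_frame (dim V) (L \<circ> v) (L \<circ> w))"
      by (rule append_frame_cong[OF V]) (use L is_frame_in[OF w] in auto)
    then show ?thesis by (simp add: append_frame_comp det_frame_matrix_comp L(1))
  qed
  have nz: "?d v' \<noteq> 0" "?d v \<noteq> 0" using det_append_frame_nonzero V v v' w by auto
  show ?thesis
  proof
    assume "same_oriented V v v'"
    then obtain L where "linear L" "\<forall>i<dim V. L (v i) = v' i" "\<forall>x\<in>V\<^sup>\<bottom>. L x = x" "det (matrix L) > 0"
      unfolding same_oriented_def by blast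
    then show "std_positive (append_frame (dim V) v w) \<longleftrightarrow> std_positive (append_frame (dim V) v' w)"
      using det[of L] by (simp add: std_positive_iff zero_less_mult_iff)
  next
    assume eq: "std_positive (append_frame (dim V) v w) \<longleftrightarrow> std_positive (append_frame (dim V) v' w)"
    obtain L where L: "linear L" "\<forall>i<dim V. L (v i) = v' i" "\<forall>w\<in>V\<^sup>\<bottom>. L w = w"
      using frame_change_exists[OF V v v'] .
    \<comment> \<open>\<open>std_positive\<close> only separates positive from nonpositive;
      nonvanishing of both frame determinants makes the latter mean negative and excludes a zero
      factor.\<close>
    have "det (matrix L) > 0"
      using eq nz det[OF L] unfolding std_positive_iff
      by (cases "det (matrix L)" "0::real" rule: linorder_cases) (auto simp: zero_less_mult_iff linorder_neq_iff)
    then show "same_oriented V v v'"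
      unfolding same_oriented_def using L by blast
  qed
qed

text \<open>The definition tests \<open>w\<close> against all tangent frames, but one suffices:
  exchanging the tangent frame either flips both sides of the test or leaves both as they
  are.\<close>

lemma normal_orientation_iff:
  assumes T: "subspace (tangent_space M x)" and or: "is_orientation (tangent_space M x) (orient x)"
    and v: "is_frame (tangent_space M x) v" and w: "is_frame (normal_space M x) w"
  shows "w \<in> normal_orientation M orient x \<longleftrightarrow>
    (v \<in> orient x \<longleftrightarrow> std_positive (append_frame (dim (tangent_space M x)) v w))"
proof -
  have "(v \<in> orient x \<longleftrightarrow> v' \<in> orient x) \<longleftrightarrow> (std_positive (append_frame (dim (tangent_space M x)) v w)
      \<longleftrightarrow> std_positive (append_frame (dim (tangent_space M x)) v' w))"
    if "is_frame (tangent_space M x) v'" for v'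
    using or v that same_oriented_iff_std_positive[OF T v that w] unfolding is_orientation_def by blast
  then show ?thesis
    unfolding normal_orientation_def mem_Collect_eq using v w by blast
qed

lemma normal_orientation_cong:
  assumes T: "subspace (tangent_space M x)" and w: "is_frame (normal_space M x) w"
    and eq: "\<And>i. i < dim (normal_space M x) \<Longrightarrow> w i = w' i"
  shows "w \<in> normal_orientation M orient x \<longleftrightarrow> w' \<in> normal_orientation M orient x"
proof -
  have "is_frame (normal_space M x) w'" using w is_frame_cong eq by blast
  moreover have "std_positive (append_frame (dim (tangent_space M x)) v w) \<longleftrightarrow>
      std_positive (append_frame (dim (tangent_space M x)) v w')" for v
    unfolding std_positive_iff by (subst append_frame_cong[OF T _ eq]) auto
  ultimately show ?thesis using w by (simp add: normal_orientation_def)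
qed

text \<open>This equivalence serves both directions of the theorem: read from right to left it puts
  \<open>p\<close> into the bundle, read from left to right it makes the reconstructed isometry
  orientation preserving.\<close>

lemma orientation_preserving_normal_iff:
  assumes T: "subspace (tangent_space M x)" and or: "is_orientation (tangent_space M x) (orient x)"
    and T': "subspace (tangent_space M' x')" and or': "is_orientation (tangent_space M' x') (orient' x')"
    and L: "linear L" "inj L" "L ` tangent_space M x = tangent_space M' x'"
      "L ` normal_space M x = normal_space M' x'"
    and pres: "orientation_preserving (tangent_space M x) (orient x) (orient' x') L"
  shows "orientation_preserving (normal_space M x) (normal_orientation M orient x)
      (normal_orientation M' orient' x') L \<longleftrightarrow> det (matrix L) > 0"
proof -
  let ?d = "dim (tangent_space M x)"
  obtain v where v: "is_frame (tangent_space M x) v" using is_frame_exists[OF T] .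
  \<comment> \<open>\<open>orientation_preserving\<close> is a universal statement over frames; an
    actual normal frame is required to conclude anything about the determinant from it. In
    codimension zero this is the empty frame.\<close>
  obtain w0 where w0: "is_frame (normal_space M x) w0"
    using is_frame_exists[OF subspace_orthogonal_comp] .
  have inj: "inj_on L A" for A using L(2) by (rule inj_on_subset) simp
  have Lv: "is_frame (tangent_space M' x') (L \<circ> v)" and d: "dim (tangent_space M' x') = ?d"
    using is_frame_image[OF L(1) inj T v] by (simp_all add: L(3))
  have *: "(w \<in> normal_orientation M orient x \<longleftrightarrow> L \<circ> w \<in> normal_orientation M' orient' x') \<longleftrightarrow> det (matrix L) > 0"
    if w: "is_frame (normal_space M x) w" for w
  proof -
    have Lw: "is_frame (normal_space M' x') (L \<circ> w)"
      using is_frame_image(1)[OF L(1) inj subspace_orthogonal_comp w] by (simp add: L(4))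
    have det: "det (frame_matrix (append_frame ?d (L \<circ> v) (L \<circ> w))) = det (matrix L) * det (frame_matrix (append_frame ?d v w))"
      by (simp add: append_frame_comp det_frame_matrix_comp L(1))
    have nz: "det (frame_matrix (append_frame ?d (L \<circ> v) (L \<circ> w))) \<noteq> 0"
      using det_append_frame_nonzero[OF T' Lv Lw] by (simp add: d)
    have "(w \<in> normal_orientation M orient x \<longleftrightarrow> L \<circ> w \<in> normal_orientation M' orient' x') \<longleftrightarrow>
        (std_positive (append_frame ?d v w) \<longleftrightarrow> std_positive (append_frame ?d (L \<circ> v) (L \<circ> w)))"
      unfolding normal_orientation_iff[where orient = orient, OF T or v w] normal_orientation_iff[where orient = orient', OF T' or' Lv Lw] d
      using pres v unfolding orientation_preserving_def by blast
    also have "\<dots> \<longleftrightarrow> det (matrix L) > 0"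
      using nz unfolding std_positive_iff det
      by (cases "det (matrix L)" "0::real" rule: linorder_cases) (auto simp: zero_less_mult_iff linorder_neq_iff)
    finally show ?thesis .
  qed
  show ?thesis
    unfolding orientation_preserving_def using * w0 by blast
qed

text \<open>Maps that agree on \<open>V\<close> send a frame of \<open>V\<close> to frames that
  agree below the dimension and possibly nowhere else; the last hypothesis says that positivity
  ignores the difference. It is instantiated for tangent and for normal orientations.\<close>

lemma orientation_preserving_cong:
  assumes V: "subspace V" and L: "linear L" "inj_on L V" "L ` V = V'"
    and eq: "\<And>v. v \<in> V \<Longrightarrow> L v = K v"
    and Or': "\<And>b c. is_frame V' b \<Longrightarrow> (\<And>i. i < dim V' \<Longrightarrow> b i = c i) \<Longrightarrow> b \<in> Or' \<longleftrightarrow> c \<in> Or'"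
  shows "orientation_preserving V Or Or' L \<longleftrightarrow> orientation_preserving V Or Or' K"
proof -
  have "L \<circ> b \<in> Or' \<longleftrightarrow> K \<circ> b \<in> Or'" if b: "is_frame V b" for b
  proof (rule Or')
    show "is_frame V' (L \<circ> b)" using is_frame_image(1)[OF L(1,2) V b] by (simp add: L(3))
    show "(L \<circ> b) i = (K \<circ> b) i" if "i < dim V'" for i
      using eq[OF is_frame_in[OF b, of i]] that is_frame_image(2)[OF L(1,2) V b] unfolding L(3) by simp
  qed
  then show ?thesis by (simp add: orientation_preserving_def)
qed

section \<open>Curves in a submanifold\<close>

lemma norm_matrix_le:
  fixes A :: "((real, 'n::finite) vec, 'm::finite) vec"
  assumes "\<And>i j. \<bar>A $ i $ j\<bar> \<le> K"
  shows "norm A \<le> real CARD('m) * (real CARD('n) * K)"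
proof -
  have "norm (A $ i) \<le> real CARD('n) * K" for i
    using order_trans[OF norm_le_l1_cart sum_bounded_above[of UNIV "\<lambda>j. \<bar>A $ i $ j\<bar>" K]] assms by simp
  then have "(\<Sum>i\<in>UNIV. norm (A $ i)) \<le> real CARD('m) * (real CARD('n) * K)"
    using sum_bounded_above[of UNIV "\<lambda>i. norm (A $ i)"] by simp
  moreover have "norm A \<le> (\<Sum>i\<in>UNIV. norm (A $ i))"
    unfolding norm_vec_def by (rule L2_set_le_sum) simp
  ultimately show ?thesis by linarith
qed

lemma dist_matrix_le:
  fixes f g :: "('n::finite) euc \<Rightarrow> ('m::finite) euc"
  assumes "\<And>v. norm (f v - g v) \<le> K * norm v"
  shows "dist (matrix f) (matrix g) \<le> real CARD('m) * (real CARD('n) * K)"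
  unfolding dist_norm
proof (rule norm_matrix_le)
  fix i j
  have "\<bar>(matrix f - matrix g) $ i $ j\<bar> = \<bar>(f (axis j 1) - g (axis j 1)) $ i\<bar>"
    by (simp add: matrix_def)
  also have "\<dots> \<le> norm (f (axis j 1) - g (axis j 1))" by (rule component_le_norm_cart)
  also have "\<dots> \<le> K" using assms[of "axis j 1"] by simp
  finally show "\<bar>(matrix f - matrix g) $ i $ j\<bar> \<le> K" .
qed

lemma bounded_bilinear_matrix_matrix_mult:
  "bounded_bilinear ((**) :: ((real, 'n::finite) vec, 'm::finite) vec \<Rightarrow> ((real, 'l::finite) vec, 'n) vec \<Rightarrow> _)"
  unfolding bilinear_conv_bounded_bilinear[symmetric] bilinear_def linear_iff
  by (simp add: matrix_add_ldistrib matrix_matrix_mult_def vec_eq_iff sum.distrib algebra_simps sum_distrib_left)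

lemma bounded_bilinear_matrix_vector_mult:
  "bounded_bilinear ((*v) :: ((real, 'n::finite) vec, 'm::finite) vec \<Rightarrow> (real, 'n) vec \<Rightarrow> _)"
  unfolding bilinear_conv_bounded_bilinear[symmetric] bilinear_def linear_iff
  by (simp add: matrix_vector_mult_def vec_eq_iff sum.distrib algebra_simps sum_distrib_left)

text \<open>In matrix form, restriction to the tangent spaces along the curve becomes right
  multiplication by an absolutely continuous matrix.\<close>

lemma abs_continuous_proj_tangent_space:
  fixes M :: "('k::finite) euc set"
  assumes M: "embedded_submanifold n M" and x: "abs_continuous a b x" "\<And>t. t \<in> {a..b} \<Longrightarrow> x t \<in> M"
  shows "abs_continuous a b (\<lambda>t. matrix (proj (tangent_space M (x t))))"
proof (rule abs_continuous_locally_lipschitz[OF x])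
  fix y assume "y \<in> M"
  then obtain r C where r: "r > 0" and C: "\<And>u v e. u \<in> M \<inter> ball y r \<Longrightarrow> v \<in> M \<inter> ball y r \<Longrightarrow>
       norm (proj (tangent_space M u) e - proj (tangent_space M v) e) \<le> C * dist u v * norm e"
    by (rule proj_tangent_space_locally_lipschitz[OF M]) blast
  have "dist (matrix (proj (tangent_space M u))) (matrix (proj (tangent_space M v)))
      \<le> (real CARD('k) * (real CARD('k) * C)) * dist u v" if "u \<in> M \<inter> ball y r" "v \<in> M \<inter> ball y r" for u v
    using dist_matrix_le[OF C[OF that]] by (simp add: mult.assoc)
  then show "\<exists>U K. open U \<and> y \<in> U \<and> (\<forall>u\<in>M \<inter> U. \<forall>v\<in>M \<inter> U.
      dist (matrix (proj (tangent_space M u))) (matrix (proj (tangent_space M v))) \<le> K * dist u v)"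
    using r by (intro exI[of _ "ball y r"] exI[of _ "real CARD('k) * (real CARD('k) * C)"] conjI ballI) auto
qed

text \<open>Dropping the two endpoints gives each remaining time a neighbourhood inside the
  interval, as the two-sided derivatives in the rolling conditions require.\<close>

lemma AE_lebesgue_on_interior: "AE t in lebesgue_on {a..b}. t \<in> {a<..<b::real}"
proof -
  have "AE t in lebesgue. t \<notin> {a, b}"
    by (rule AE_not_in) (simp flip: negligible_iff_null_sets)
  then show ?thesis
    by (subst AE_restrict_space_iff) (auto elim: eventually_mono)
qed

text \<open>Both the field and its covariant derivative lie in \<open>E t\<close>, where the two
  maps agree. At interior times the transported fields agree on a neighbourhood, so their
  derivatives coincide.\<close>

lemma commutes_with_D_cong:
  assumes "commutes_with_D \<tau> E E' L" and E: "\<And>t. t \<in> {0..\<tau>} \<Longrightarrow> subspace (E t)"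
    and eq: "\<And>t v. t \<in> {0..\<tau>} \<Longrightarrow> v \<in> E t \<Longrightarrow> L t v = K t v"
  shows "commutes_with_D \<tau> E E' K"
  unfolding commutes_with_D_def
proof (intro allI impI)
  fix Z assume Z: "ac_field_along \<tau> E Z"
  with assms(1) have "AE t in lebesgue_on {0..\<tau>}. \<exists>Y. has_covariant_derivative Z Y (E t) t \<and>
           has_covariant_derivative (\<lambda>s. L s (Z s)) (L t Y) (E' t) t"
    unfolding commutes_with_D_def by blast
  with AE_lebesgue_on_interior show "AE t in lebesgue_on {0..\<tau>}. \<exists>Y. has_covariant_derivative Z Y (E t) t \<and>
           has_covariant_derivative (\<lambda>s. K s (Z s)) (K t Y) (E' t) t"
  proof eventually_elim
    case (elim t)
    then obtain Y w where Y: "has_covariant_derivative Z Y (E t) t"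
      and w: "((\<lambda>s. L s (Z s)) has_vector_derivative w) (at t)" "L t Y = proj (E' t) w"
      unfolding has_covariant_derivative_def by blast
    have "Y \<in> E t" using Y E elim(1) by (auto simp: has_covariant_derivative_def proj_in)
    then have "L t Y = K t Y" using eq elim(1) by simp
    moreover have "((\<lambda>s. K s (Z s)) has_vector_derivative w) (at t)"
      by (rule has_vector_derivative_transform_within_open[OF w(1) open_greaterThanLessThan elim(1)])
        (use Z in \<open>auto simp: ac_field_along_def intro: eq\<close>)
    ultimately show ?case using Y w(2) unfolding has_covariant_derivative_def by metis
  qed
qed

lemma maps_velocity_cong:
  assumes "maps_velocity \<tau> x x' L" and M: "embedded_submanifold n M" and x: "\<And>t. t \<in> {0..\<tau>} \<Longrightarrow> x t \<in> M"
    and eq: "\<And>t v. t \<in> {0..\<tau>} \<Longrightarrow> v \<in> tangent_space M (x t) \<Longrightarrow> L t v = K t v"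
  shows "maps_velocity \<tau> x x' K"
  using AE_lebesgue_on_interior assms(1) unfolding maps_velocity_def
proof eventually_elim
  case (elim t)
  then obtain v where v: "(x has_vector_derivative v) (at t)" "(x' has_vector_derivative L t v) (at t)" by blast
  have "\<forall>\<^sub>F s in nhds t. s \<in> {0<..<\<tau>}" using elim(1) by (intro eventually_nhds_in_open) auto
  then have "\<forall>\<^sub>F s in nhds t. x s \<in> M" by eventually_elim (simp add: x)
  then have "v \<in> tangent_space M (x t)" by (rule velocity_in_tangent_space[OF M v(1)])
  then have "L t v = K t v" using eq elim(1) by simp
  then show ?case using v by auto
qed

section \<open>Isometries and rollings\<close>

text \<open>After subtracting its value at 0 an isometry fixes the origin and is therefore linear,
  hence its own derivative everywhere. So the point at which \<open>diff_along\<close>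
  differentiates does not affect the result.\<close>

lemma Isom_plus_affine:
  fixes g :: "('k::finite) euc \<Rightarrow> 'k euc"
  assumes "g \<in> Isom_plus"
  defines "A \<equiv> frechet_derivative g (at 0)"
  shows "orthogonal_transformation A" and "det (matrix A) > 0"
    and "frechet_derivative g (at y) = A" and "g y = g z + A (y - z)"
proof -
  define f where "f y = g y - g 0" for y
  have dist: "dist (g y) (g z) = dist y z" for y z using assms(1) by (simp add: Isom_plus_def)
  have f: "linear f"
    by (rule isometry_linear) (simp_all add: f_def dist_norm, use dist in \<open>simp add: dist_norm\<close>)
  have norm: "norm (f v) = norm v" for v using dist[of v 0] by (simp add: f_def dist_norm)
  have "(g has_derivative f) (at y)" for y
  proof -
    have "((\<lambda>y. f y + g 0) has_derivative f) (at y)"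
      using linear_imp_has_derivative[OF f] by (auto intro!: derivative_eq_intros)
    then show ?thesis by (simp add: f_def[abs_def])
  qed
  then have fd: "frechet_derivative g (at y) = f" for y using frechet_derivative_at by metis
  then have Af: "A = f" by (simp add: A_def)
  show "orthogonal_transformation A" unfolding Af orthogonal_transformation using f norm by simp
  show "det (matrix A) > 0" using assms(1) fd by (simp add: Isom_plus_def Af)
  show "frechet_derivative g (at y) = A" using fd Af by simp
  show "g y = g z + A (y - z)" unfolding Af using linear_diff[OF f, of y z] by (simp add: f_def)
qed

lemma affine_Isom_plus:
  fixes A :: "('k::finite) euc \<Rightarrow> 'k euc"
  assumes A: "orthogonal_transformation A" and det: "det (matrix A) > 0"
  shows "(\<lambda>y. c + A (y - a)) \<in> Isom_plus" and "frechet_derivative (\<lambda>y. c + A (y - a)) (at z) = A"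
proof -
  have lin: "linear A" using A by (rule orthogonal_transformation_linear)
  have "((\<lambda>y. c + A (y - a)) has_derivative A) (at z)" for z
  proof -
    have "((\<lambda>y. A y + (c - A a)) has_derivative A) (at z)"
      using linear_imp_has_derivative[OF lin] by (auto intro!: derivative_eq_intros)
    then show ?thesis by (simp add: linear_diff[OF lin] algebra_simps)
  qed
  then have fd: "frechet_derivative (\<lambda>y. c + A (y - a)) (at z) = A" for z
    using frechet_derivative_at by metis
  then show "frechet_derivative (\<lambda>y. c + A (y - a)) (at z) = A" .
  have "dist (c + A (y - a)) (c + A (z - a)) = dist y z" for y z
    using A unfolding orthogonal_transformation by (simp add: dist_norm flip: linear_diff[OF lin])
  then show "(\<lambda>y. c + A (y - a)) \<in> Isom_plus" by (simp add: Isom_plus_def fd det)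
qed

text \<open>Condition (ii') speaks of tangent spaces only; preservation of inner products together
  with surjectivity yields the same for normal spaces.\<close>

lemma orthogonal_transformation_image_comp:
  fixes A :: "'v::euclidean_space \<Rightarrow> 'v"
  assumes A: "orthogonal_transformation A" and V: "A ` V = V'"
  shows "A ` (V\<^sup>\<bottom>) = V'\<^sup>\<bottom>"
proof -
  have inner: "A u \<bullet> A v = u \<bullet> v" for u v using A by (simp add: orthogonal_transformation_def)
  have "u \<in> V\<^sup>\<bottom> \<longleftrightarrow> A u \<in> V'\<^sup>\<bottom>" for u
    unfolding orthogonal_comp_iff V[symmetric] by (simp add: inner)
  then show ?thesis using orthogonal_transformation_surj[OF A] by (auto simp: image_iff) (metis surjD)
qed

lemma restr_eq: "subspace V \<Longrightarrow> v \<in> V \<Longrightarrow> restr L V v = L v"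
  by (simp add: restr_def proj_id)

lemma restr_Isom0_plus:
  fixes A :: "('k::finite) euc \<Rightarrow> 'k euc"
  assumes A: "orthogonal_transformation A" and V: "subspace V" and im: "A ` V = V'"
    and pres: "orientation_preserving V Or Or' A"
    and Or': "\<And>b c. is_frame V' b \<Longrightarrow> (\<And>i. i < dim V' \<Longrightarrow> b i = c i) \<Longrightarrow> b \<in> Or' \<longleftrightarrow> c \<in> Or'"
  shows "restr A V \<in> Isom0_plus V Or V' Or'"
proof -
  have lin: "linear A" using A by (rule orthogonal_transformation_linear)
  have inj: "inj_on A V" by (rule inj_on_subset[OF orthogonal_transformation_inj[OF A]]) simp
  have "linear (restr A V)"
    unfolding restr_def using linear_compose[OF linear_proj[OF V] lin] by (simp add: o_def)
  moreover have "restr A V ` V = V'" unfolding im[symmetric] by (rule image_cong) (simp_all add: restr_eq V)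
  moreover have "\<forall>v\<in>V. \<forall>w\<in>V. restr A V v \<bullet> restr A V w = v \<bullet> w"
    using A by (simp add: restr_eq V orthogonal_transformation_def)
  moreover have "orientation_preserving V Or Or' (restr A V)"
  proof -
    have eq: "A v = restr A V v" if "v \<in> V" for v using restr_eq[OF V that] by (rule sym)
    show ?thesis using orientation_preserving_cong[OF V lin inj im eq Or'] pres by (rule iffD1)
  qed
  moreover have "\<forall>w\<in>V\<^sup>\<bottom>. restr A V w = 0"
    by (simp add: restr_def proj_zero V linear_0[OF lin])
  ultimately show ?thesis by (simp add: Isom0_plus_def)
qed

text \<open>Extended by zero, \<open>q\<close> sees only the component of a vector in
  \<open>T\<close> and \<open>p\<close> only the other one. The two images lie in complementary
  orthogonal subspaces, so Pythagoras in source and target shows that the sum preserves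
  norms.\<close>

lemma Isom0_plus_glue:
  fixes T T' :: "('k::finite) euc set"
  assumes T: "subspace T" and T': "subspace T'"
    and q: "q \<in> Isom0_plus T Or T' Or'" and p: "p \<in> Isom0_plus (T\<^sup>\<bottom>) Or2 (T'\<^sup>\<bottom>) Or2'"
  defines "A \<equiv> \<lambda>v. q v + p v"
  shows "orthogonal_transformation A" and "\<And>v. v \<in> T \<Longrightarrow> A v = q v" and "\<And>v. v \<in> T\<^sup>\<bottom> \<Longrightarrow> A v = p v"
    and "restr A T = q" and "restr A (T\<^sup>\<bottom>) = p"
proof -
  have lq: "linear q" and q0: "\<And>w. w \<in> T\<^sup>\<bottom> \<Longrightarrow> q w = 0" and qT: "q ` T = T'"
    and qi: "\<And>v w. v \<in> T \<Longrightarrow> w \<in> T \<Longrightarrow> q v \<bullet> q w = v \<bullet> w"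
    using q by (auto simp: Isom0_plus_def)
  have lp: "linear p" and p0: "\<And>w. w \<in> T \<Longrightarrow> p w = 0" and pN: "p ` (T\<^sup>\<bottom>) = T'\<^sup>\<bottom>"
    and pi: "\<And>v w. v \<in> T\<^sup>\<bottom> \<Longrightarrow> w \<in> T\<^sup>\<bottom> \<Longrightarrow> p v \<bullet> p w = v \<bullet> w"
    using p by (auto simp: Isom0_plus_def orthogonal_comp_self T)
  show AT: "A v = q v" if "v \<in> T" for v using p0 that by (simp add: A_def)
  show AN: "A v = p v" if "v \<in> T\<^sup>\<bottom>" for v using q0 that by (simp add: A_def)
  have q_proj: "q (proj T v) = q v" for v
    using linear_diff[OF lq, of v "proj T v"] q0[OF diff_proj_in[OF T]] by simp
  have p_proj: "p (v - proj T v) = p v" for v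
    using linear_diff[OF lp, of v "proj T v"] p0[OF proj_in[OF T]] by simp
  show "restr A T = q" by (simp add: restr_def fun_eq_iff AT proj_in T q_proj)
  show "restr A (T\<^sup>\<bottom>) = p" by (simp add: restr_def fun_eq_iff proj_orthogonal_comp T AN diff_proj_in p_proj)
  have "norm (A v) = norm v" for v
  proof -
    have "q (proj T v) \<in> T'" using qT proj_in[OF T] by blast
    moreover have "p (v - proj T v) \<in> T'\<^sup>\<bottom>" using pN diff_proj_in[OF T] by blast
    ultimately have "orthogonal (q v) (p v)" by (simp add: q_proj p_proj orthogonal_comp_iff orthogonal_def)
    then have "(norm (A v))\<^sup>2 = (norm (q v))\<^sup>2 + (norm (p v))\<^sup>2"
      unfolding A_def by (rule norm_add_Pythagorean)
    also have "norm (q v) = norm (proj T v)"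
      using qi[OF proj_in[OF T] proj_in[OF T], of v v] by (simp add: q_proj norm_eq_sqrt_inner)
    also have "norm (p v) = norm (v - proj T v)"
      using pi[OF diff_proj_in[OF T] diff_proj_in[OF T], of v v] by (simp only: p_proj norm_eq_sqrt_inner)
    finally have "(norm (A v))\<^sup>2 = (norm v)\<^sup>2" by (simp only: norm_proj_sq[OF T, of v])
    then show ?thesis by (rule power2_eq_imp_eq) simp_all
  qed
  then show "orthogonal_transformation A"
    unfolding orthogonal_transformation using linear_compose_add[OF lq lp] by (simp add: A_def)
qed

section \<open>The two directions of the correspondence\<close>

lemma rolling_induces_intrinsic:
  fixes M M' :: "('k::{finite,linorder}) euc set"
  assumes M: "oriented_submanifold n M orM" and M': "oriented_submanifold n M' orM'"
    and roll: "is_rolling \<tau> M orM M' orM' x g"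
  defines "x' \<equiv> \<lambda>t. g t (x t)" and "q \<equiv> tangent_part M x g" and "p \<equiv> normal_part M x g"
  shows "ac_curve_in_QP \<tau> M orM M' orM' x x' q p" and "intrinsic_rolling_conditions \<tau> M M' x x' q p"
proof -
  define A where "A t = frechet_derivative (g t) (at 0)" for t
  have eM: "embedded_submanifold n M" and eM': "embedded_submanifold n M'"
    using M M' by (simp_all add: oriented_submanifold_def)
  have roll': "\<And>t. t \<in> {0..\<tau>} \<Longrightarrow> x t \<in> M" "\<And>t. t \<in> {0..\<tau>} \<Longrightarrow> g t \<in> Isom_plus"
    "abs_continuous 0 \<tau> x" "abs_continuous_isom 0 \<tau> g" "\<And>t. t \<in> {0..\<tau>} \<Longrightarrow> x' t \<in> M'"
    "\<And>t. t \<in> {0..\<tau>} \<Longrightarrow> diff_along x g t ` tangent_space M (x t) = tangent_space M' (x' t)"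
    "maps_velocity \<tau> x x' (diff_along x g)"
    "commutes_with_D \<tau> (\<lambda>t. tangent_space M (x t)) (\<lambda>t. tangent_space M' (x' t)) (diff_along x g)"
    "commutes_with_D \<tau> (\<lambda>t. normal_space M (x t)) (\<lambda>t. normal_space M' (x' t)) (diff_along x g)"
    "\<And>t. t \<in> {0..\<tau>} \<Longrightarrow>
       orientation_preserving (tangent_space M (x t)) (orM (x t)) (orM' (x' t)) (diff_along x g t)"
    using roll unfolding is_rolling_def Let_def x'_def by simp_all
  have T: "subspace (tangent_space M (x t))" and T': "subspace (tangent_space M' (x' t))"
    and or: "is_orientation (tangent_space M (x t)) (orM (x t))"
    and or': "is_orientation (tangent_space M' (x' t)) (orM' (x' t))" if "t \<in> {0..\<tau>}" for t
    using subspace_tangent_space[OF eM roll'(1)] subspace_tangent_space[OF eM' roll'(5)] that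
      M M' roll'(1,5) by (simp_all add: oriented_submanifold_def)
  have A: "orthogonal_transformation (A t)" and det: "det (matrix (A t)) > 0"
    and dg: "diff_along x g t = A t" and g: "g t y = g t z + A t (y - z)" if "t \<in> {0..\<tau>}" for t y z
    using Isom_plus_affine[OF roll'(2)[OF that]] by (simp_all add: A_def diff_along_def)
  have q: "q t = restr (A t) (tangent_space M (x t))"
    and p: "p t = restr (A t) (normal_space M (x t))" if "t \<in> {0..\<tau>}" for t
    using dg[OF that] by (simp_all add: q_def p_def tangent_part_def normal_part_def)
  have im: "A t ` tangent_space M (x t) = tangent_space M' (x' t)" if "t \<in> {0..\<tau>}" for t
    using roll'(6) dg that by simp
  have pres: "orientation_preserving (tangent_space M (x t)) (orM (x t)) (orM' (x' t)) (A t)"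
    if "t \<in> {0..\<tau>}" for t using roll'(10) dg that by simp
  have "(x t, x' t, q t, p t) \<in> QP_bundle M orM M' orM'" if t: "t \<in> {0..\<tau>}" for t
  proof -
    note im_perp = orthogonal_transformation_image_comp[OF A[OF t] im[OF t]]
    have "q t \<in> Isom0_plus (tangent_space M (x t)) (orM (x t)) (tangent_space M' (x' t)) (orM' (x' t))"
      unfolding q[OF t]
      by (rule restr_Isom0_plus[OF A[OF t] T[OF t] im[OF t] pres[OF t]]) (rule is_orientation_cong[OF or'[OF t]])
    \<comment> \<open>The positive determinant demanded by \<open>Isom_plus\<close> is used here,
      since a rolling by definition only preserves tangent orientations.\<close>
    moreover have "orientation_preserving (normal_space M (x t)) (normal_orientation M orM (x t))
        (normal_orientation M' orM' (x' t)) (A t)"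
      using orientation_preserving_normal_iff[where orient = orM and orient' = orM', OF T[OF t] or[OF t] T'[OF t] or'[OF t]
          orthogonal_transformation_linear[OF A[OF t]] orthogonal_transformation_inj[OF A[OF t]]
          im[OF t] im_perp pres[OF t]] det[OF t] by simp
    then have "p t \<in> Isom0_plus (normal_space M (x t)) (normal_orientation M orM (x t))
        (normal_space M' (x' t)) (normal_orientation M' orM' (x' t))"
      unfolding p[OF t]
      by (rule restr_Isom0_plus[OF A[OF t] subspace_orthogonal_comp im_perp])
        (rule normal_orientation_cong[OF T'[OF t]])
    ultimately show ?thesis
      using roll'(1,5) t by (simp add: QP_bundle_def Q_bundle_def P_bundle_def)
  qed
  moreover have "abs_continuous 0 \<tau> (\<lambda>t. (x t, x' t, matrix (q t), matrix (p t)))"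
  proof -
    have acA: "abs_continuous 0 \<tau> (\<lambda>t. matrix (A t))" and acg: "abs_continuous 0 \<tau> (\<lambda>t. g t 0)"
      unfolding A_def using roll'(4)[unfolded abs_continuous_isom_def]
      by (rule abs_continuous_fst abs_continuous_snd)+
    have lin: "linear (A t)" if "t \<in> {0..\<tau>}" for t
      by (rule orthogonal_transformation_linear[OF A[OF that]])
    have "abs_continuous 0 \<tau> (\<lambda>t. g t 0 + matrix (A t) *v x t)"
      by (intro abs_continuous_add acg bounded_bilinear.abs_continuous[OF bounded_bilinear_matrix_vector_mult] acA roll'(3))
    then have acx': "abs_continuous 0 \<tau> x'"
    proof (rule abs_continuous_cong)
      fix t assume t: "t \<in> {0..\<tau>}"
      show "g t 0 + matrix (A t) *v x t = x' t"
        using g[OF t, of "x t" 0] by (simp add: x'_def fun_cong[OF matrix_vector_mul(2)[OF lin[OF t]]])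
    qed
    \<comment> \<open>The extended \<open>q t\<close> is \<open>A t\<close> after the tangent
      projection; as the two projections add up to the identity, \<open>p t\<close> is then obtained
      as the difference of \<open>A t\<close> and \<open>q t\<close>.\<close>
    have "abs_continuous 0 \<tau> (\<lambda>t. matrix (A t) ** matrix (proj (tangent_space M (x t))))"
      by (intro bounded_bilinear.abs_continuous[OF bounded_bilinear_matrix_matrix_mult] acA
          abs_continuous_proj_tangent_space[OF eM roll'(3)] roll'(1))
    then have acq: "abs_continuous 0 \<tau> (\<lambda>t. matrix (q t))"
    proof (rule abs_continuous_cong)
      fix t assume t: "t \<in> {0..\<tau>}"
      show "matrix (A t) ** matrix (proj (tangent_space M (x t))) = matrix (q t)"
        unfolding q[OF t] restr_def using matrix_compose[OF linear_proj[OF T[OF t]] lin[OF t]] by (simp add: o_def)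
    qed
    have "abs_continuous 0 \<tau> (\<lambda>t. matrix (A t) - matrix (q t))"
      by (intro abs_continuous_diff acA acq)
    then have acp: "abs_continuous 0 \<tau> (\<lambda>t. matrix (p t))"
    proof (rule abs_continuous_cong)
      fix t assume t: "t \<in> {0..\<tau>}"
      show "matrix (A t) - matrix (q t) = matrix (p t)"
        unfolding p[OF t] q[OF t]
        by (simp add: restr_def matrix_def vec_eq_iff proj_orthogonal_comp[OF T[OF t]] linear_diff[OF lin[OF t]])
    qed
    show ?thesis by (intro abs_continuous_Pair roll'(3) acx' acq acp)
  qed
  ultimately show "ac_curve_in_QP \<tau> M orM M' orM' x x' q p"
    by (simp add: ac_curve_in_QP_def)
  have eq_q: "diff_along x g t v = q t v" if "t \<in> {0..\<tau>}" "v \<in> tangent_space M (x t)" for t v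
    using that by (simp add: q dg restr_eq T)
  have eq_p: "diff_along x g t v = p t v" if "t \<in> {0..\<tau>}" "v \<in> normal_space M (x t)" for t v
    using that by (simp add: p dg restr_eq subspace_orthogonal_comp)
  show "intrinsic_rolling_conditions \<tau> M M' x x' q p"
    unfolding intrinsic_rolling_conditions_def
    by (intro conjI maps_velocity_cong[OF roll'(7) eM roll'(1) eq_q] commutes_with_D_cong[OF roll'(8) T eq_q]
        commutes_with_D_cong[OF roll'(9) subspace_orthogonal_comp eq_p])
qed

lemma intrinsic_induces_rolling:
  fixes M M' :: "('k::{finite,linorder}) euc set"
  assumes M: "oriented_submanifold n M orM" and M': "oriented_submanifold n M' orM'"
    and curve: "ac_curve_in_QP \<tau> M orM M' orM' x x' q p"
    and intr: "intrinsic_rolling_conditions \<tau> M M' x x' q p"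
  defines "g \<equiv> \<lambda>t y. x' t + (if t \<in> {0..\<tau>} then \<lambda>v. q t v + p t v else id) (y - x t)"
  shows "is_rolling \<tau> M orM M' orM' x g" and "induces \<tau> M x g x x' q p"
    and "is_rolling \<tau> M orM M' orM' z h \<Longrightarrow> induces \<tau> M z h x x' q p \<Longrightarrow> t \<in> {0..\<tau>} \<Longrightarrow> h t = g t"
proof -
  define A where "A t v = q t v + p t v" for t v
  have eM: "embedded_submanifold n M" and eM': "embedded_submanifold n M'"
    using M M' by (simp_all add: oriented_submanifold_def)
  have x: "x t \<in> M" and x': "x' t \<in> M'"
    and q: "q t \<in> Isom0_plus (tangent_space M (x t)) (orM (x t)) (tangent_space M' (x' t)) (orM' (x' t))"
    and p: "p t \<in> Isom0_plus (normal_space M (x t)) (normal_orientation M orM (x t))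
        (normal_space M' (x' t)) (normal_orientation M' orM' (x' t))" if "t \<in> {0..\<tau>}" for t
    using curve that by (auto simp: ac_curve_in_QP_def QP_bundle_def Q_bundle_def P_bundle_def)
  have T: "subspace (tangent_space M (x t))" and T': "subspace (tangent_space M' (x' t))"
    and or: "is_orientation (tangent_space M (x t)) (orM (x t))"
    and or': "is_orientation (tangent_space M' (x' t)) (orM' (x' t))" if "t \<in> {0..\<tau>}" for t
    using subspace_tangent_space[OF eM x] subspace_tangent_space[OF eM' x'] that
      M M' x x' by (simp_all add: oriented_submanifold_def)
  have A: "orthogonal_transformation (A t)" and Aq: "\<And>v. v \<in> tangent_space M (x t) \<Longrightarrow> A t v = q t v"
    and Ap: "\<And>v. v \<in> normal_space M (x t) \<Longrightarrow> A t v = p t v"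
    and restr_q: "restr (A t) (tangent_space M (x t)) = q t"
    and restr_p: "restr (A t) (normal_space M (x t)) = p t" if "t \<in> {0..\<tau>}" for t
    using Isom0_plus_glue[OF T[OF that] T'[OF that] q[OF that] p[OF that]]
    unfolding A_def[abs_def] by blast+
  have lin: "linear (A t)" and inj: "inj (A t)" if "t \<in> {0..\<tau>}" for t
    using A[OF that] orthogonal_transformation_linear orthogonal_transformation_inj by blast+
  have g: "g t = (\<lambda>y. x' t + A t (y - x t))" if "t \<in> {0..\<tau>}" for t
    using that by (simp add: g_def A_def)
  have im: "A t ` tangent_space M (x t) = tangent_space M' (x' t)" if "t \<in> {0..\<tau>}" for t
    using q[OF that] Aq[OF that] by (simp add: Isom0_plus_def cong: image_cong)
  have im_perp: "A t ` normal_space M (x t) = normal_space M' (x' t)" if "t \<in> {0..\<tau>}" for t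
    by (rule orthogonal_transformation_image_comp[OF A[OF that] im[OF that]])
  have inj_on: "inj_on (A t) V" if "t \<in> {0..\<tau>}" for t V by (rule inj_on_subset[OF inj[OF that]]) simp
  have pres: "orientation_preserving (tangent_space M (x t)) (orM (x t)) (orM' (x' t)) (A t)"
    if t: "t \<in> {0..\<tau>}" for t
  proof (rule iffD2[OF orientation_preserving_cong[OF T[OF t] lin[OF t] inj_on[OF t] im[OF t] Aq[OF t] is_orientation_cong[OF or'[OF t]]]])
    show "orientation_preserving (tangent_space M (x t)) (orM (x t)) (orM' (x' t)) (q t)"
      using q[OF t] by (simp add: Isom0_plus_def)
  qed
  have pres_perp: "orientation_preserving (normal_space M (x t)) (normal_orientation M orM (x t))
      (normal_orientation M' orM' (x' t)) (A t)" if t: "t \<in> {0..\<tau>}" for t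
  proof (rule iffD2[OF orientation_preserving_cong[OF subspace_orthogonal_comp lin[OF t] inj_on[OF t] im_perp[OF t] Ap[OF t] normal_orientation_cong[OF T'[OF t]]]])
    show "orientation_preserving (normal_space M (x t)) (normal_orientation M orM (x t))
      (normal_orientation M' orM' (x' t)) (p t)"
      using p[OF t] by (simp add: Isom0_plus_def)
  qed
  \<comment> \<open>The orientation conditions on \<open>q t\<close> and \<open>p t\<close> together
    determine the sign of the determinant of their sum.\<close>
  have det: "det (matrix (A t)) > 0" if t: "t \<in> {0..\<tau>}" for t
    using orientation_preserving_normal_iff[where orient = orM and orient' = orM', OF T[OF t] or[OF t] T'[OF t] or'[OF t]
          lin[OF t] inj[OF t] im[OF t] im_perp[OF t] pres[OF t]] pres_perp[OF t] by simp
  have g_isom: "g t \<in> Isom_plus" and fd: "frechet_derivative (g t) (at y) = A t" if "t \<in> {0..\<tau>}" for t y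
    unfolding g[OF that] by (rule affine_Isom_plus[OF A[OF that] det[OF that]])+
  have dg: "diff_along x g t = A t" if "t \<in> {0..\<tau>}" for t
    using fd[OF that] by (simp add: diff_along_def)
  \<comment> \<open>Equality is wanted at all real times, so that the function of \<open>t\<close>
    formed in \<open>is_rolling\<close> can be rewritten to \<open>x'\<close>. Outside the interval
    nothing is known of \<open>q t\<close> and \<open>p t\<close>, not even linearity; the value
    \<open>id\<close> in the definition of \<open>g\<close> makes the increment at
    \<open>x t\<close> vanish there too.\<close>
  have gx: "g t (x t) = x' t" for t
    by (cases "t \<in> {0..\<tau>}") (use lin linear_0 in \<open>auto simp: g, auto simp: g_def\<close>)
  have ac: "abs_continuous 0 \<tau> (\<lambda>t. (x t, x' t, matrix (q t), matrix (p t)))"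
    using curve by (simp add: ac_curve_in_QP_def)
  note acx = abs_continuous_fst[OF ac] and ac2 = abs_continuous_snd[OF ac]
  note acx' = abs_continuous_fst[OF ac2] and ac3 = abs_continuous_snd[OF ac2]
  note acq = abs_continuous_fst[OF ac3] and acp = abs_continuous_snd[OF ac3]
  have acA: "abs_continuous 0 \<tau> (\<lambda>t. matrix (A t))"
    by (rule abs_continuous_cong[OF abs_continuous_add[OF acq acp]]) (simp add: A_def matrix_def vec_eq_iff)
  \<comment> \<open>These are the linear part of \<open>g t\<close> and its translation part, the
    value at the origin.\<close>
  have "abs_continuous 0 \<tau> (\<lambda>t. (matrix (A t), x' t - matrix (A t) *v x t))"
    by (intro abs_continuous_Pair abs_continuous_diff
        bounded_bilinear.abs_continuous[OF bounded_bilinear_matrix_vector_mult] acA acx acx')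
  then have g_ac: "abs_continuous_isom 0 \<tau> g"
    unfolding abs_continuous_isom_def
  proof (rule abs_continuous_cong)
    fix t assume t: "t \<in> {0..\<tau>}"
    show "(matrix (A t), x' t - matrix (A t) *v x t) = (matrix (frechet_derivative (g t) (at 0)), g t 0)"
      unfolding fd[OF t] using linear_neg[OF lin[OF t], of "x t"]
      by (simp add: g[OF t] fun_cong[OF matrix_vector_mul(2)[OF lin[OF t]]])
  qed
  have eq_q: "q t v = diff_along x g t v" if "t \<in> {0..\<tau>}" "v \<in> tangent_space M (x t)" for t v
    using that by (simp add: dg Aq)
  have eq_p: "p t v = diff_along x g t v" if "t \<in> {0..\<tau>}" "v \<in> normal_space M (x t)" for t v
    using that by (simp add: dg Ap)
  have intr': "maps_velocity \<tau> x x' q"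
     "commutes_with_D \<tau> (\<lambda>t. tangent_space M (x t)) (\<lambda>t. tangent_space M' (x' t)) q"
     "commutes_with_D \<tau> (\<lambda>t. normal_space M (x t)) (\<lambda>t. normal_space M' (x' t)) p"
    using intr by (simp_all add: intrinsic_rolling_conditions_def)
  show "is_rolling \<tau> M orM M' orM' x g"
    unfolding is_rolling_def Let_def gx
    using maps_velocity_cong[OF intr'(1) eM x eq_q] commutes_with_D_cong[OF intr'(2) T eq_q]
      commutes_with_D_cong[OF intr'(3) subspace_orthogonal_comp eq_p]
    by (simp add: x x' g_isom acx g_ac dg im pres)
  show "induces \<tau> M x g x x' q p"
    by (simp add: induces_def gx tangent_part_def normal_part_def dg restr_q restr_p)
  show "h t = g t" if h: "is_rolling \<tau> M orM M' orM' z h" "induces \<tau> M z h x x' q p" and t: "t \<in> {0..\<tau>}"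
  proof
    fix y
    have h_isom: "h t \<in> Isom_plus" using h(1) t by (simp add: is_rolling_def Let_def)
    define B where "B = frechet_derivative (h t) (at 0)"
    have B: "orthogonal_transformation B" and hd: "\<And>y. frechet_derivative (h t) (at y) = B"
      and h_eq: "\<And>y z. h t y = h t z + B (y - z)"
      unfolding B_def by (rule Isom_plus_affine[OF h_isom])+
    have zx: "z t = x t" and hx: "h t (x t) = x' t"
      and "restr B (tangent_space M (x t)) = q t" "restr B (normal_space M (x t)) = p t"
      using bspec[OF h(2)[unfolded induces_def] t]
      by (auto simp: tangent_part_def normal_part_def diff_along_def hd)
    \<comment> \<open>The prescribed restrictions determine \<open>B\<close> on both summands of
      each vector, hence everywhere; the prescribed value at \<open>x t\<close> then fixes the
      translation.\<close>
    then have "A t v = B (proj (tangent_space M (x t)) v) + B (v - proj (tangent_space M (x t)) v)" for v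
      unfolding A_def by (auto simp: restr_def fun_eq_iff proj_orthogonal_comp[OF T[OF t]])
    then have "A t v = B v" for v
      using linear_add[OF orthogonal_transformation_linear[OF B]] by (metis add.commute diff_add_cancel)
    then show "h t y = g t y" using h_eq[of y "x t"] by (simp add: g[OF t] hx)
  qed
qed

theorem proposition1:
  fixes M M' :: "('k::{finite,linorder}) euc set"
    and orM orM' :: "'k euc orientation_field"
    and n \<nu> :: nat
    and \<tau> :: real
  assumes "CARD('k) = n + \<nu>"
    and "oriented_submanifold n M orM" and "connected M"
    and "oriented_submanifold n M' orM'" and "connected M'"
    and "0 \<le> \<tau>"
  shows
    "(\<forall>x g. is_rolling \<tau> M orM M' orM' x g \<longrightarrow>
        (let x' = (\<lambda>t. g t (x t)); q = tangent_part M x g; p = normal_part M x g in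
           ac_curve_in_QP \<tau> M orM M' orM' x x' q p \<and>
           intrinsic_rolling_conditions \<tau> M M' x x' q p)) \<and>
     (\<forall>x x' q p.
        ac_curve_in_QP \<tau> M orM M' orM' x x' q p \<and>
        intrinsic_rolling_conditions \<tau> M M' x x' q p \<longrightarrow>
        (\<exists>y g. is_rolling \<tau> M orM M' orM' y g \<and> induces \<tau> M y g x x' q p \<and>
           (\<forall>z h. is_rolling \<tau> M orM M' orM' z h \<and> induces \<tau> M z h x x' q p \<longrightarrow>
              (\<forall>t\<in>{0..\<tau>}. z t = y t \<and> h t = g t))))"
proof (intro conjI allI impI)
  fix x g assume "is_rolling \<tau> M orM M' orM' x g"
  from rolling_induces_intrinsic[OF assms(2,4) this]
  show "let x' = (\<lambda>t. g t (x t)); q = tangent_part M x g; p = normal_part M x g in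
           ac_curve_in_QP \<tau> M orM M' orM' x x' q p \<and> intrinsic_rolling_conditions \<tau> M M' x x' q p"
    by (simp add: Let_def)
next
  fix x x' q p
  assume *: "ac_curve_in_QP \<tau> M orM M' orM' x x' q p \<and> intrinsic_rolling_conditions \<tau> M M' x x' q p"
  note rolling = intrinsic_induces_rolling[OF assms(2,4) conjunct1[OF *] conjunct2[OF *]]
  show "\<exists>y g. is_rolling \<tau> M orM M' orM' y g \<and> induces \<tau> M y g x x' q p \<and>
           (\<forall>z h. is_rolling \<tau> M orM M' orM' z h \<and> induces \<tau> M z h x x' q p \<longrightarrow>
              (\<forall>t\<in>{0..\<tau>}. z t = y t \<and> h t = g t))"
  proof (intro exI conjI allI impI ballI)
    show "is_rolling \<tau> M orM M' orM' x (\<lambda>t y. x' t + (if t \<in> {0..\<tau>} then \<lambda>v. q t v + p t v else id) (y - x t))"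
      by (rule rolling(1))
    show "induces \<tau> M x (\<lambda>t y. x' t + (if t \<in> {0..\<tau>} then \<lambda>v. q t v + p t v else id) (y - x t)) x x' q p"
      by (rule rolling(2))
    fix z h t assume zh: "is_rolling \<tau> M orM M' orM' z h \<and> induces \<tau> M z h x x' q p" and t: "t \<in> {0..\<tau>}"
    then show "z t = x t" by (simp add: induces_def)
    show "h t = (\<lambda>y. x' t + (if t \<in> {0..\<tau>} then \<lambda>v. q t v + p t v else id) (y - x t))"
      by (rule rolling(3)[OF conjunct1[OF zh] conjunct2[OF zh] t])
  qed
qed

end
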